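(* Let $\rho:=\{r_1,\ldots,r_n\}$ be a set of nodes with $0<r_1<\ldots<r_n$, $n\ge 2$, and let $h:=\max_{1\le j\le n-1}(r_{j+1}-r_j)$. For an integer $k\neq 0$, let $g:(0,\infty)\to\mathbb{R}$ be a data function such that $g\in\Lambda_1$ if $|k|=1$, while $g\in\Lambda_2$ if $|k|\ge 2$. Let $\sigma\in\mathcal{S}_k(\rho)$ be the unique Beppo Levi $L_k$-spline on $\rho$ such that $\sigma(r_j)=g(r_j)$ for $1\le j\le n$. Then, for $m\in\{0,1\}$, the following error bounds hold: $$\left\|\frac{d^m}{dr^m}(g-\sigma)\right\|_{L^\infty[r_1,r_n]}\le\frac{1}{2^{1-m}\sqrt{r_1}}\,h^{3/2-m}\,\|g\|_k,$$ $$\left\|\frac{d^m}{dr^m}(g-\sigma)\right\|_{L^2[r_1,r_n]}\le\frac{1}{2^{1-m}\sqrt{r_1}}\,h^{2-m}\,\|g\|_k.$$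
   Context: For an integer $k\neq 0$ define the ordinary differential operators on $(0,\infty)$ $$L_k:=r\frac{d^4}{dr^4}+2\frac{d^3}{dr^3}-\frac{2k^2+1}{r}\frac{d^2}{dr^2}+\frac{2k^2+1}{r^2}\frac{d}{dr}+\frac{k^4-4k^2}{r^3}=r\left(\frac{d^2}{dr^2}+\frac1r\frac{d}{dr}-\frac{k^2}{r^2}\right)^2,$$ $$G_k:=\frac1r\left[\frac{d^2}{dr^2}-\frac{2|k|+1}{r}\frac{d}{dr}+\frac{|k|(|k|+2)}{r^2}\right],\qquad R_k:=\frac1r\left[\frac{d^2}{dr^2}+\frac{2|k|-1}{r}\frac{d}{dr}+\frac{|k|(|k|-2)}{r^2}\right].$$ Let $\rho=\{r_1,\ldots,r_n\}$ with $0<r_1<\ldots<r_n$. A function $\eta:[0,\infty)\to\mathbb{C}$ is called a Beppo Levi $L_k$-spline on $\rho$ if: (i) $L_k\eta(r)=0$ for all $r\in(r_j,r_{j+1})$ and all $j\in\{1,\ldots,n-1\}$; (ii) $G_k\eta(r)=0$ for all $r\in(0,r_1)$ and $R_k\eta(r)=0$ for all $r>r_n$; (iii) $\eta$ is $C^2$-continuous at each knot $r_1,\ldots,r_n$. The value at $0$ is understood by continuity, i.e. $\eta(0)=0$. The space of all Beppo Levi $L_k$-splines on $\rho$ is denoted $\mathcal{S}_k(\rho)$. For $n\ge2$, $k\ne0$ and given real values $\nu_1,\ldots,\nu_n$ there is a unique $\sigma\in\mathcal{S}_k(\rho)$ with $\sigma(r_j)=\nu_j$ for all $j$. $AC_{\mathrm{loc}}(0,\infty)$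 is the vector space of functions $\psi:(0,\infty)\to\mathbb{C}$ that are absolutely continuous on every interval $[a,b]$, $0<a<b<\infty$. $\Lambda_1$ is the vector space of functions $\psi\in C^1(0,\infty)$ with $\psi'\in AC_{\mathrm{loc}}(0,\infty)$ such that $r^{1/2}\psi''$ and $r^{-1/2}\psi'-r^{-3/2}\psi$ belong to $L^2(0,\infty)$. $\Lambda_2$ is the vector space of functions $\psi\in C^1(0,\infty)$ with $\psi'\in AC_{\mathrm{loc}}(0,\infty)$ such that $r^{1/2}\psi''$, $r^{-1/2}\psi'$ and $r^{-3/2}\psi$ all belong to $L^2(0,\infty)$. For $\psi\in\Lambda_1$ (if $|k|=1$) or $\psi\in\Lambda_2$ (if $|k|\ge2$), $$\|\psi\|_k^2:=\int_0^\infty\left\{\left|\frac{d^2\psi}{dr^2}\right|^2+2k^2\left|\frac{\psi}{r^2}-\frac1r\frac{d\psi}{dr}\right|^2+\left|k^2\frac{\psi}{r^2}-\frac1r\frac{d\psi}{dr}\right|^2\right\}r\,dr.$$ *)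

theory Defs
  imports "HOL-Analysis.Analysis" "HOL-Probability.Essential_Supremum"
begin

(* Functions on (0,oo) or [0,oo) are total functions on the reals. All notions below depend
   only on the values on the intended domain, since derivatives are taken at interior points. *)

(* At a point of non-differentiability vderiv is an unspecified value, so differentiability is
   always stated separately (or, for the a.e. second derivative in Lambda1 and Lambda2, it
   follows from local absolute continuity of the first derivative). *)
definition vderiv :: "(real \<Rightarrow> complex) \<Rightarrow> real \<Rightarrow> complex" where
  "vderiv f = (\<lambda>r. vector_derivative f (at r))"

definition Cn_on :: "nat \<Rightarrow> (real \<Rightarrow> complex) \<Rightarrow> real set \<Rightarrow> bool" where
  "Cn_on n f S \<longleftrightarrow>
     (\<forall>m<n. \<forall>x\<in>S. ((vderiv ^^ m) f) differentiable (at x)) \<and> continuous_on S ((vderiv ^^ n) f)"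

definition AC_on :: "(real \<Rightarrow> complex) \<Rightarrow> real \<Rightarrow> real \<Rightarrow> bool" where
  "AC_on f a b \<longleftrightarrow>
     (\<forall>\<epsilon>>0. \<exists>\<delta>>0. \<forall>(n::nat) (u::nat \<Rightarrow> real) (v::nat \<Rightarrow> real).
        (\<forall>i<n. a \<le> u i \<and> u i \<le> v i \<and> v i \<le> b) \<and>
        (\<forall>i<n. \<forall>j<n. i \<noteq> j \<longrightarrow> {u i<..<v i} \<inter> {u j<..<v j} = {}) \<and>
        (\<Sum>i<n. v i - u i) < \<delta>
        \<longrightarrow> (\<Sum>i<n. norm (f (v i) - f (u i))) < \<epsilon>)"

definition AC_loc :: "(real \<Rightarrow> complex) set" where
  "AC_loc = {f. \<forall>a b. 0 < a \<and> a < b \<longrightarrow> AC_on f a b}"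

definition L2_on :: "real set \<Rightarrow> (real \<Rightarrow> complex) set" where
  "L2_on S = {f. f \<in> borel_measurable (lebesgue_on S) \<and>
                 integrable (lebesgue_on S) (\<lambda>x. (norm (f x))\<^sup>2)}"

(* Both norms take the value infinity outside the respective space. *)
definition L2_norm :: "real set \<Rightarrow> (real \<Rightarrow> complex) \<Rightarrow> ereal" where
  "L2_norm S f =
     (if f \<in> L2_on S then ereal (sqrt (LINT x|lebesgue_on S. (norm (f x))\<^sup>2)) else \<infinity>)"

definition Linf_norm :: "real set \<Rightarrow> (real \<Rightarrow> complex) \<Rightarrow> ereal" where
  "Linf_norm S f = esssup (lebesgue_on S) (\<lambda>x. ereal (norm (f x)))"

definition L_op :: "int \<Rightarrow> (real \<Rightarrow> complex) \<Rightarrow> real \<Rightarrow> complex" where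
  "L_op k \<eta> r = (let k = real_of_int k in
       r *\<^sub>R (vderiv ^^ 4) \<eta> r
     + 2 *\<^sub>R (vderiv ^^ 3) \<eta> r
     - ((2 * k\<^sup>2 + 1) / r) *\<^sub>R (vderiv ^^ 2) \<eta> r
     + ((2 * k\<^sup>2 + 1) / r\<^sup>2) *\<^sub>R vderiv \<eta> r
     + ((k ^ 4 - 4 * k\<^sup>2) / r ^ 3) *\<^sub>R \<eta> r)"

definition G_op :: "int \<Rightarrow> (real \<Rightarrow> complex) \<Rightarrow> real \<Rightarrow> complex" where
  "G_op k \<eta> r = (let k = \<bar>real_of_int k\<bar> in
     (1 / r) *\<^sub>R ((vderiv ^^ 2) \<eta> r
       - ((2 * k + 1) / r) *\<^sub>R vderiv \<eta> r
       + (k * (k + 2) / r\<^sup>2) *\<^sub>R \<eta> r))"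

definition R_op :: "int \<Rightarrow> (real \<Rightarrow> complex) \<Rightarrow> real \<Rightarrow> complex" where
  "R_op k \<eta> r = (let k = \<bar>real_of_int k\<bar> in
     (1 / r) *\<^sub>R ((vderiv ^^ 2) \<eta> r
       + ((2 * k - 1) / r) *\<^sub>R vderiv \<eta> r
       + (k * (k - 2) / r\<^sup>2) *\<^sub>R \<eta> r))"

(* The knots are r 1 < ... < r n. The equations hold in the classical sense, so the solution
   pieces are required to have continuous derivatives up to the order of the operator. *)
definition BL_splines :: "int \<Rightarrow> nat \<Rightarrow> (nat \<Rightarrow> real) \<Rightarrow> (real \<Rightarrow> complex) set" where
  "BL_splines k n r = {\<eta>.
     (\<forall>j\<in>{1..<n}. Cn_on 4 \<eta> {r j<..<r (Suc j)} \<and> (\<forall>x\<in>{r j<..<r (Suc j)}. L_op k \<eta> x = 0)) \<and>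
     (Cn_on 2 \<eta> {0<..<r 1} \<and> (\<forall>x\<in>{0<..<r 1}. G_op k \<eta> x = 0)) \<and>
     (Cn_on 2 \<eta> {r n<..} \<and> (\<forall>x\<in>{r n<..}. R_op k \<eta> x = 0)) \<and>
     (\<forall>j\<in>{1..n}. \<exists>e>0. Cn_on 2 \<eta> {r j - e<..<r j + e}) \<and>
     \<eta> 0 = 0}"

definition Lambda1 :: "(real \<Rightarrow> complex) set" where
  "Lambda1 = {\<psi>. \<psi> C1_differentiable_on {0<..} \<and> vderiv \<psi> \<in> AC_loc \<and>
     (\<lambda>r. (r powr (1/2)) *\<^sub>R (vderiv ^^ 2) \<psi> r) \<in> L2_on {0<..} \<and>
     (\<lambda>r. (r powr (-1/2)) *\<^sub>R vderiv \<psi> r - (r powr (-3/2)) *\<^sub>R \<psi> r) \<in> L2_on {0<..}}"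

definition Lambda2 :: "(real \<Rightarrow> complex) set" where
  "Lambda2 = {\<psi>. \<psi> C1_differentiable_on {0<..} \<and> vderiv \<psi> \<in> AC_loc \<and>
     (\<lambda>r. (r powr (1/2)) *\<^sub>R (vderiv ^^ 2) \<psi> r) \<in> L2_on {0<..} \<and>
     (\<lambda>r. (r powr (-1/2)) *\<^sub>R vderiv \<psi> r) \<in> L2_on {0<..} \<and>
     (\<lambda>r. (r powr (-3/2)) *\<^sub>R \<psi> r) \<in> L2_on {0<..}}"

definition energy_norm :: "int \<Rightarrow> (real \<Rightarrow> complex) \<Rightarrow> real" where
  "energy_norm k \<psi> = (let k = real_of_int k in
     sqrt (LINT r|lebesgue_on {0<..}.
       ((norm ((vderiv ^^ 2) \<psi> r))\<^sup>2
        + 2 * k\<^sup>2 * (norm ((1 / r\<^sup>2) *\<^sub>R \<psi> r - (1 / r) *\<^sub>R vderiv \<psi> r))\<^sup>2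
        + (norm ((k\<^sup>2 / r\<^sup>2) *\<^sub>R \<psi> r - (1 / r) *\<^sub>R vderiv \<psi> r))\<^sup>2) * r))"

end

theory Submission
  imports Defs
begin

text \<open>Write \<open>e = g - \<sigma>\<close>. The error bounds follow from \<open>\<integral> |e''|\<^sup>2 r dr \<le> \<parallel>g\<parallel>\<^sub>k\<^sup>2\<close> over \<open>[r\<^sub>1, r\<^sub>n]\<close>: on each subinterval
  \<open>e\<close> vanishes at the end points, so \<open>e'\<close> has a zero, and Cauchy--Schwarz bounds \<open>e'\<close> and then \<open>e\<close>.

  For the energy inequality, completing squares with the operators \<open>G\<^sub>k\<close> and \<open>R\<^sub>k\<close> bounds the energy of \<open>g\<close> on
  \<open>(0, r\<^sub>1)\<close> and \<open>(r\<^sub>n, \<infinity>)\<close> from below by quadratic forms in \<open>g, g'\<close> at \<open>r\<^sub>1\<close> and \<open>r\<^sub>n\<close>; the boundary terms at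
  \<open>0\<close> and \<open>\<infinity>\<close> vanish along suitable sequences. In between, integration by parts of the energy inner product of
  \<open>e\<close> and \<open>\<sigma>\<close> leaves only the terms \<open>r e' \<sigma>''\<close> at \<open>r\<^sub>1\<close> and \<open>r\<^sub>n\<close>, and the conditions \<open>G\<^sub>k \<sigma> = 0\<close>, \<open>R\<^sub>k \<sigma> = 0\<close>
  make these cancel against the cross terms of the quadratic forms.

  Since \<open>g'\<close> is merely absolutely continuous, this needs the fundamental theorem of calculus for absolutely
  continuous functions. Such a function is a difference of two nondecreasing absolutely continuous functions,
  the Stieltjes measures of these have Radon--Nikodym densities, and indefinite integrals are differentiable
  almost everywhere.\<close>

text \<open>The spline itself is used only on [r_1, r_n]. Its outer pieces enter through the limits
  of their equations at r_1 and r_n, and the outer energy of g is handled by forms whose derivative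
  along a function u is the energy density minus r times the square of r G_k u or r R_k u. Two
  obstacles shape the argument. For |k| = 1 neither g / r nor g' is controlled near 0 and
  \<infinity>, only g' - g / r; but for c = 1 and c = -1 the form is a multiple of the square of
  just this combination. And a spline is only C^2 at the knots, so nothing is given about
  \<sigma>''' there; the differential equation keeps it bounded inside each interval, and it is
  multiplied by e, which vanishes at the knots. The constants arise as follows: the weight r \<ge>
  r_1 gives 1 / sqrt r_1, the zeros of e at both ends of an interval give 1/2, and keeping each
  interval's own share of the energy until the summation gives the L^2 bounds. The spline is complex
  valued a priori; its real and imaginary parts are treated by the same estimate.\<close>

section \<open>Absolutely continuous functions\<close>

definition subintervals :: "'i set \<Rightarrow> ('i \<Rightarrow> real) \<Rightarrow> ('i \<Rightarrow> real) \<Rightarrow> real \<Rightarrow> real \<Rightarrow> bool" where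
  "subintervals I u v a b \<longleftrightarrow> finite I \<and> (\<forall>i\<in>I. a \<le> u i \<and> u i \<le> v i \<and> v i \<le> b) \<and>
     disjoint_family_on (\<lambda>i. {u i<..<v i}) I"

definition abs_cont :: "(real \<Rightarrow> real) \<Rightarrow> real \<Rightarrow> real \<Rightarrow> bool" where
  "abs_cont f a b \<longleftrightarrow> (\<forall>\<epsilon>>0. \<exists>\<delta>>0. \<forall>(I::nat set) u v. subintervals I u v a b \<and> (\<Sum>i\<in>I. v i - u i) < \<delta>
     \<longrightarrow> (\<Sum>i\<in>I. \<bar>f (v i) - f (u i)\<bar>) < \<epsilon>)"

lemma subintervals_reindex:
  assumes "subintervals I u v a b" "bij_betw h J I"
  shows "subintervals J (u \<circ> h) (v \<circ> h) a b"
  unfolding subintervals_def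
proof (intro conjI ballI)
  show "finite J" using assms bij_betw_finite unfolding subintervals_def by blast
  show "a \<le> (u \<circ> h) i" "(u \<circ> h) i \<le> (v \<circ> h) i" "(v \<circ> h) i \<le> b" if "i \<in> J" for i
    using assms(1) bij_betw_apply[OF assms(2) that] unfolding subintervals_def by auto
  show "disjoint_family_on (\<lambda>i. {(u \<circ> h) i<..<(v \<circ> h) i}) J"
    unfolding disjoint_family_on_def
  proof (intro ballI impI)
    fix i j assume "i \<in> J" "j \<in> J" "i \<noteq> j"
    then have "h i \<in> I" "h j \<in> I" "h i \<noteq> h j"
      using assms(2) unfolding bij_betw_def by (auto dest: inj_onD)
    then show "{(u \<circ> h) i<..<(v \<circ> h) i} \<inter> {(u \<circ> h) j<..<(v \<circ> h) j} = {}"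
      using assms(1) unfolding subintervals_def disjoint_family_on_def comp_def by blast
  qed
qed

text \<open>A definition cannot quantify over index types, so \<open>abs_cont\<close> speaks of
  \<open>nat\<close>; renumbering a finite family carries the estimate to any index type.
  \<open>abs_cont_variation\<close> indexes by pairs,
  \<open>interval_measure_absolutely_continuous\<close> by the intervals themselves.\<close>

lemma abs_contE:
  assumes "abs_cont f a b" "0 < \<epsilon>"
  obtains \<delta> where "0 < \<delta>"
    "\<And>I u v. subintervals I u v a b \<Longrightarrow> (\<Sum>i\<in>I. v i - u i) < \<delta> \<Longrightarrow>
      (\<Sum>i\<in>(I::'i set). \<bar>f (v i) - f (u i)\<bar>) < \<epsilon>"
proof -
  obtain \<delta> where \<delta>: "0 < \<delta>" "\<forall>(I::nat set) u v. subintervals I u v a b \<and> (\<Sum>i\<in>I. v i - u i) < \<delta>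
     \<longrightarrow> (\<Sum>i\<in>I. \<bar>f (v i) - f (u i)\<bar>) < \<epsilon>"
    using assms(1)[unfolded abs_cont_def, THEN spec, THEN mp, OF assms(2)] by (elim exE conjE) (rule that)
  show thesis
  proof (rule that[OF \<delta>(1)])
    fix I :: "'i set" and u v
    assume s: "subintervals I u v a b" and len: "(\<Sum>i\<in>I. v i - u i) < \<delta>"
    obtain h where h: "bij_betw h {..<card I} I"
      using s ex_bij_betw_nat_finite[of I] unfolding subintervals_def atLeast0LessThan by auto
    have "(\<Sum>i<card I. (v \<circ> h) i - (u \<circ> h) i) < \<delta>"
      using len sum.reindex_bij_betw[OF h, of "\<lambda>i. v i - u i"] by simp
    then have "(\<Sum>i<card I. \<bar>f ((v \<circ> h) i) - f ((u \<circ> h) i)\<bar>) < \<epsilon>"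
      using \<delta>(2) subintervals_reindex[OF s h] by blast
    then show "(\<Sum>i\<in>I. \<bar>f (v i) - f (u i)\<bar>) < \<epsilon>"
      using sum.reindex_bij_betw[OF h, of "\<lambda>i. \<bar>f (v i) - f (u i)\<bar>"] by simp
  qed
qed

lemma AC_on_imp_abs_cont:
  assumes "AC_on F a b" "\<And>x. x \<in> {a..b} \<Longrightarrow> f x = Re (F x)"
  shows "abs_cont f a b"
  unfolding abs_cont_def
proof (intro allI impI)
  fix \<epsilon> :: real assume "\<epsilon> > 0"
  obtain \<delta> where \<delta>: "\<delta> > 0" "\<forall>(n::nat) u v. (\<forall>i<n. a \<le> u i \<and> u i \<le> v i \<and> v i \<le> b) \<and>
        (\<forall>i<n. \<forall>j<n. i \<noteq> j \<longrightarrow> {u i<..<v i} \<inter> {u j<..<v j} = {}) \<and>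
        (\<Sum>i<n. v i - u i) < \<delta> \<longrightarrow> (\<Sum>i<n. norm (F (v i) - F (u i))) < \<epsilon>"
    using assms(1)[unfolded AC_on_def, THEN spec, THEN mp, OF \<open>\<epsilon> > 0\<close>] by (elim exE conjE) (rule that)
  show "\<exists>\<delta>>0. \<forall>(I::nat set) u v. subintervals I u v a b \<and> (\<Sum>i\<in>I. v i - u i) < \<delta>
     \<longrightarrow> (\<Sum>i\<in>I. \<bar>f (v i) - f (u i)\<bar>) < \<epsilon>"
  proof (intro exI[of _ \<delta>] conjI allI impI \<delta>(1); elim conjE)
    fix I :: "nat set" and u v
    assume s: "subintervals I u v a b" and len: "(\<Sum>i\<in>I. v i - u i) < \<delta>"
    obtain h where h: "bij_betw h {..<card I} I"
      using s ex_bij_betw_nat_finite[of I] unfolding subintervals_def atLeast0LessThan by auto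
    have len': "(\<Sum>i<card I. (v \<circ> h) i - (u \<circ> h) i) < \<delta>"
      using len sum.reindex_bij_betw[OF h, of "\<lambda>i. v i - u i"] by simp
    have s': "subintervals {..<card I} (u \<circ> h) (v \<circ> h) a b"
      by (rule subintervals_reindex[OF s h])
    have "(\<Sum>i\<in>I. \<bar>f (v i) - f (u i)\<bar>) \<le> (\<Sum>i\<in>I. norm (F (v i) - F (u i)))"
    proof (rule sum_mono)
      fix i assume "i \<in> I"
      then have "u i \<in> {a..b}" "v i \<in> {a..b}" using s unfolding subintervals_def by force+
      then show "\<bar>f (v i) - f (u i)\<bar> \<le> norm (F (v i) - F (u i))"
        using assms(2) abs_Re_le_cmod[of "F (v i) - F (u i)"] by simp
    qed
    also have "\<dots> = (\<Sum>i<card I. norm (F ((v \<circ> h) i) - F ((u \<circ> h) i)))"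
      using sum.reindex_bij_betw[OF h, of "\<lambda>i. norm (F (v i) - F (u i))"] by simp
    also have "\<dots> < \<epsilon>"
      using s' len' unfolding subintervals_def disjoint_family_on_def
      by (intro \<delta>(2)[rule_format] conjI) auto
    finally show "(\<Sum>i\<in>I. \<bar>f (v i) - f (u i)\<bar>) < \<epsilon>" .
  qed
qed

lemma subintervals_mono:
  "subintervals I u v a b \<Longrightarrow> a' \<le> a \<Longrightarrow> b \<le> b' \<Longrightarrow> subintervals I u v a' b'"
  unfolding subintervals_def by fastforce

lemma abs_cont_subset:
  assumes "abs_cont f a b" "a \<le> a'" "b' \<le> b"
  shows "abs_cont f a' b'"
  unfolding abs_cont_def
proof (intro allI impI)
  fix \<epsilon> :: real assume "\<epsilon> > 0"
  from abs_contE[OF assms(1) this] obtain \<delta> where \<delta>: "0 < \<delta>"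
    "\<And>(I::nat set) u v. subintervals I u v a b \<Longrightarrow> (\<Sum>i\<in>I. v i - u i) < \<delta> \<Longrightarrow>
      (\<Sum>i\<in>I. \<bar>f (v i) - f (u i)\<bar>) < \<epsilon>" by blast
  show "\<exists>\<delta>>0. \<forall>(I::nat set) u v. subintervals I u v a' b' \<and> (\<Sum>i\<in>I. v i - u i) < \<delta>
     \<longrightarrow> (\<Sum>i\<in>I. \<bar>f (v i) - f (u i)\<bar>) < \<epsilon>"
    using \<delta> subintervals_mono[OF _ assms(2,3)] by (intro exI[of _ \<delta>]) blast
qed

lemma subintervals_singleton: "x \<le> y \<Longrightarrow> subintervals {0::nat} (\<lambda>_. x) (\<lambda>_. y) x y"
  unfolding subintervals_def disjoint_family_on_def by auto

text \<open>Intervals beyond \<open>y\<close> degenerate to the point \<open>y\<close> rather than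
  being discarded. The index set stays the same, so truncations from both sides can be summed term
  by term.\<close>

lemma subintervals_min:
  "subintervals I u v x z \<Longrightarrow> x \<le> y \<Longrightarrow> subintervals I (\<lambda>i. min (u i) y) (\<lambda>i. min (v i) y) x y"
proof -
  assume H: "subintervals I u v x z" "x \<le> y"
  have "finite I" "\<And>i. i \<in> I \<Longrightarrow> x \<le> u i \<and> u i \<le> v i \<and> v i \<le> z" "disjoint_family_on (\<lambda>i. {u i<..<v i}) I"
    using H(1) unfolding subintervals_def by auto
  moreover have "{min (u i) y<..<min (v i) y} \<subseteq> {u i<..<v i}" for i by (auto simp: min_def split: if_splits)
  ultimately show ?thesis
    unfolding subintervals_def using H(2) disjoint_family_on_bisimulation
    by (intro conjI ballI) (fastforce, fastforce, fastforce, fastforce, unfold disjoint_family_on_def, blast)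
qed

lemma subintervals_max:
  "subintervals I u v x z \<Longrightarrow> y \<le> z \<Longrightarrow> subintervals I (\<lambda>i. max (u i) y) (\<lambda>i. max (v i) y) y z"
proof -
  assume H: "subintervals I u v x z" "y \<le> z"
  have "finite I" "\<And>i. i \<in> I \<Longrightarrow> x \<le> u i \<and> u i \<le> v i \<and> v i \<le> z" "disjoint_family_on (\<lambda>i. {u i<..<v i}) I"
    using H(1) unfolding subintervals_def by auto
  moreover have "{max (u i) y<..<max (v i) y} \<subseteq> {u i<..<v i}" for i by (auto simp: max_def split: if_splits)
  ultimately show ?thesis
    unfolding subintervals_def using H(2) disjoint_family_on_bisimulation
    by (intro conjI ballI) (fastforce, fastforce, fastforce, fastforce, unfold disjoint_family_on_def, blast)
qed

lemma subintervals_length: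
  assumes "subintervals I u v x y" "x \<le> y"
  shows "(\<Sum>i\<in>I. v i - u i) \<le> y - x"
proof -
  have "(\<Sum>i\<in>I. v i - u i) = (\<Sum>i\<in>I. measure lborel {u i<..<v i})"
    using assms unfolding subintervals_def by (intro sum.cong) auto
  also have "\<dots> = measure lborel (\<Union>i\<in>I. {u i<..<v i})"
    using assms unfolding subintervals_def
    by (intro measure_finite_Union[symmetric]) auto
  also have "\<dots> \<le> measure lborel {x..y}"
    using assms unfolding subintervals_def
    by (intro measure_mono_fmeasurable) (force simp: fmeasurable_def)+
  also have "\<dots> = y - x" using assms by simp
  finally show ?thesis .
qed

section \<open>Total variation of an absolutely continuous function\<close>

definition var_sums :: "(real \<Rightarrow> real) \<Rightarrow> real \<Rightarrow> real \<Rightarrow> real set" where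
  "var_sums f x y = {(\<Sum>i\<in>I. \<bar>f (v i) - f (u i)\<bar>) | (I::nat set) u v. subintervals I u v x y}"

text \<open>The usual total variation: disjoint subintervals that need not fill [x, y] give the same
  supremum as partitions. \<open>var_sums_bdd\<close> makes the supremum meaningful.\<close>

definition variation :: "(real \<Rightarrow> real) \<Rightarrow> real \<Rightarrow> real \<Rightarrow> real" where
  "variation f x y = Sup (var_sums f x y)"

lemma var_sums_nonempty: "x \<le> y \<Longrightarrow> \<bar>f y - f x\<bar> \<in> var_sums f x y"
  unfolding var_sums_def using subintervals_singleton[of x y] by force

text \<open>At most one interval of the family has \<open>y\<close> in its interior. Only there is
  the triangle inequality through \<open>f y\<close> used, which is why the conclusion is an
  inequality.\<close>

lemma var_sums_split:
  assumes "s \<in> var_sums f x z" "x \<le> y" "y \<le> z"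
  obtains s1 s2 where "s1 \<in> var_sums f x y" "s2 \<in> var_sums f y z" "s \<le> s1 + s2"
proof -
  obtain I :: "nat set" and u v where I: "subintervals I u v x z" and s: "s = (\<Sum>i\<in>I. \<bar>f (v i) - f (u i)\<bar>)"
    using assms unfolding var_sums_def by auto
  have "s \<le> (\<Sum>i\<in>I. \<bar>f (min (v i) y) - f (min (u i) y)\<bar> + \<bar>f (max (v i) y) - f (max (u i) y)\<bar>)"
    unfolding s using I unfolding subintervals_def by (intro sum_mono) (auto simp: min_def max_def)
  then have "s \<le> (\<Sum>i\<in>I. \<bar>f (min (v i) y) - f (min (u i) y)\<bar>) + (\<Sum>i\<in>I. \<bar>f (max (v i) y) - f (max (u i) y)\<bar>)"
    by (simp add: sum.distrib)
  moreover have "(\<Sum>i\<in>I. \<bar>f (min (v i) y) - f (min (u i) y)\<bar>) \<in> var_sums f x y"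
    unfolding var_sums_def mem_Collect_eq using subintervals_min[OF I assms(2)] by (intro exI conjI) (rule refl)
  moreover have "(\<Sum>i\<in>I. \<bar>f (max (v i) y) - f (max (u i) y)\<bar>) \<in> var_sums f y z"
    unfolding var_sums_def mem_Collect_eq using subintervals_max[OF I assms(3)] by (intro exI conjI) (rule refl)
  ultimately show thesis using that by blast
qed

lemma var_sums_append:
  assumes "s \<in> var_sums f x y" "x \<le> y" "y \<le> z"
  shows "s + \<bar>f z - f y\<bar> \<in> var_sums f x z"
proof -
  obtain I :: "nat set" and u v where I: "subintervals I u v x y" and s: "s = (\<Sum>i\<in>I. \<bar>f (v i) - f (u i)\<bar>)"
    using assms unfolding var_sums_def by auto
  obtain k where k: "k \<notin> I"
    using I unfolding subintervals_def by (meson ex_new_if_finite infinite_UNIV_nat)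
  let ?u = "u(k := y)" and ?v = "v(k := z)"
  have eq: "?u i = u i" "?v i = v i" if "i \<in> I" for i using that k by auto
  have "subintervals (insert k I) ?u ?v x z"
    unfolding subintervals_def
  proof (intro conjI)
    show "finite (insert k I)" using I unfolding subintervals_def by simp
    show "\<forall>i\<in>insert k I. x \<le> ?u i \<and> ?u i \<le> ?v i \<and> ?v i \<le> z"
      using I assms k unfolding subintervals_def by force
    show "disjoint_family_on (\<lambda>i. {?u i<..<?v i}) (insert k I)"
      using I k unfolding subintervals_def disjoint_family_on_def
      by (auto simp: disjoint_iff)
  qed
  moreover have "(\<Sum>i\<in>insert k I. \<bar>f (?v i) - f (?u i)\<bar>) = s + \<bar>f z - f y\<bar>"
  proof -
    have "(\<Sum>i\<in>I. \<bar>f (?v i) - f (?u i)\<bar>) = s"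
      unfolding s by (intro sum.cong refl) (simp only: eq)
    then show ?thesis using I k unfolding subintervals_def by simp
  qed
  ultimately show ?thesis unfolding var_sums_def by force
qed

context
  fixes f :: "real \<Rightarrow> real" and a b :: real
  assumes ac: "abs_cont f a b"
begin

text \<open>On an interval shorter than the \<delta> that belongs to \<epsilon> = 1 every sum is
  below 1, and boundedness passes to adjoining intervals; bisection extends it to all of
  [x, y].\<close>

lemma var_sums_bdd: "a \<le> x \<Longrightarrow> x \<le> y \<Longrightarrow> y \<le> b \<Longrightarrow> bdd_above (var_sums f x y)"
proof -
  assume xy: "a \<le> x" "x \<le> y" "y \<le> b"
  obtain \<delta> where \<delta>: "0 < \<delta>"
    "\<And>(I::nat set) u v. subintervals I u v a b \<Longrightarrow> (\<Sum>i\<in>I. v i - u i) < \<delta> \<Longrightarrow>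
      (\<Sum>i\<in>I. \<bar>f (v i) - f (u i)\<bar>) < 1"
    using abs_contE[OF ac zero_less_one] by blast
  have "x \<le> y \<longrightarrow> a \<le> x \<longrightarrow> y \<le> b \<longrightarrow> bdd_above (var_sums f x y)" using xy(2)
  proof (induction rule: Bolzano)
    case (trans p q r)
    show ?case
    proof (intro impI)
      assume "p \<le> r" "a \<le> p" "r \<le> b"
      with trans obtain B C where BC: "\<And>s. s \<in> var_sums f p q \<Longrightarrow> s \<le> B" "\<And>s. s \<in> var_sums f q r \<Longrightarrow> s \<le> C"
        unfolding bdd_above_def by fastforce
      show "bdd_above (var_sums f p r)"
      proof (rule bdd_aboveI[of _ "B + C"])
        fix s assume "s \<in> var_sums f p r"
        then show "s \<le> B + C" using var_sums_split[of s f p r q] trans BC by (smt (verit))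
      qed
    qed
  next
    case (local x)
    show ?case
    proof (intro exI[of _ \<delta>] conjI \<delta>(1) allI impI)
      fix p q assume pq: "p \<le> x \<and> x \<le> q \<and> q - p < \<delta>" "p \<le> q" "a \<le> p" "q \<le> b"
      show "bdd_above (var_sums f p q)"
      proof (rule bdd_aboveI[of _ 1])
        fix s assume "s \<in> var_sums f p q"
        then obtain I :: "nat set" and u v where I: "subintervals I u v p q" "s = (\<Sum>i\<in>I. \<bar>f (v i) - f (u i)\<bar>)"
          unfolding var_sums_def by auto
        show "s \<le> 1"
          using \<delta>(2)[OF subintervals_mono[OF I(1) pq(3,4)]] subintervals_length[OF I(1) pq(2)] pq(1) I(2)
          by simp
      qed
    qed
  qed
  with xy show ?thesis by simp
qed

lemma variation_upper: "s \<in> var_sums f x y \<Longrightarrow> a \<le> x \<Longrightarrow> x \<le> y \<Longrightarrow> y \<le> b \<Longrightarrow> s \<le> variation f x y"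
  unfolding variation_def using var_sums_bdd by (intro cSup_upper)

lemma variation_subadd:
  assumes "a \<le> x" "x \<le> y" "y \<le> z" "z \<le> b"
  shows "variation f x z \<le> variation f x y + variation f y z"
  unfolding variation_def[of f x z]
proof (rule cSup_least)
  show "var_sums f x z \<noteq> {}" using var_sums_nonempty[of x z f] assms by auto
  fix s assume "s \<in> var_sums f x z"
  then obtain s1 s2 where "s1 \<in> var_sums f x y" "s2 \<in> var_sums f y z" "s \<le> s1 + s2"
    using var_sums_split assms by blast
  then show "s \<le> variation f x y + variation f y z"
    using variation_upper[of s1 x y] variation_upper[of s2 y z] assms by linarith
qed

text \<open>With \<open>x = a\<close> this makes both \<open>variation f a\<close> and its
  difference with \<open>f\<close> nondecreasing: the Jordan decomposition.\<close>

lemma variation_increment: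
  assumes "a \<le> x" "x \<le> y" "y \<le> z" "z \<le> b"
  shows "variation f x y + \<bar>f z - f y\<bar> \<le> variation f x z"
proof -
  have "variation f x y \<le> variation f x z - \<bar>f z - f y\<bar>"
    unfolding variation_def[of f x y]
  proof (rule cSup_least)
    show "var_sums f x y \<noteq> {}" using var_sums_nonempty[of x y f] assms by auto
    fix s assume "s \<in> var_sums f x y"
    then show "s \<le> variation f x z - \<bar>f z - f y\<bar>"
      using variation_upper[of _ x z] var_sums_append[of s f x y z] assms by fastforce
  qed
  then show ?thesis by simp
qed

text \<open>An increment of the variation is at most the variation over that interval, which is
  nearly attained by a family inside it. All these families together form one disjoint family of no
  greater total length, to which the absolute continuity of \<open>f\<close> applies.\<close>

lemma abs_cont_variation: "abs_cont (variation f a) a b"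
  unfolding abs_cont_def
proof (intro allI impI)
  fix \<epsilon> :: real assume e: "\<epsilon> > 0"
  obtain \<delta> where \<delta>: "\<delta> > 0" "\<And>(I::(nat\<times>nat) set) u v. subintervals I u v a b \<Longrightarrow> (\<Sum>i\<in>I. v i - u i) < \<delta> \<Longrightarrow>
      (\<Sum>i\<in>I. \<bar>f (v i) - f (u i)\<bar>) < \<epsilon> / 2"
    using abs_contE[OF ac half_gt_zero[OF e]] by blast
  show "\<exists>\<delta>>0. \<forall>(I::nat set) u v. subintervals I u v a b \<and> (\<Sum>i\<in>I. v i - u i) < \<delta>
     \<longrightarrow> (\<Sum>i\<in>I. \<bar>variation f a (v i) - variation f a (u i)\<bar>) < \<epsilon>"
  proof (intro exI[of _ \<delta>] conjI allI impI \<delta>(1); elim conjE)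
    fix I :: "nat set" and u v
    assume s: "subintervals I u v a b" and len: "(\<Sum>i\<in>I. v i - u i) < \<delta>"
    have fin: "finite I" and uv: "\<And>i. i \<in> I \<Longrightarrow> a \<le> u i \<and> u i \<le> v i \<and> v i \<le> b"
      using s unfolding subintervals_def by auto
    \<comment> \<open>The \<open>card I\<close> approximation errors must add up to at most
      \<open>\<epsilon> / 2\<close>; the \<open>+ 1\<close> covers an empty
      \<open>I\<close>.\<close>
    define \<eta> where "\<eta> = \<epsilon> / (2 * (card I + 1))"
    have eta: "\<eta> > 0" using e unfolding \<eta>_def by simp
    have "\<exists>J p q. subintervals (J::nat set) p q (u i) (v i) \<and>
        variation f (u i) (v i) < (\<Sum>j\<in>J. \<bar>f (q j) - f (p j)\<bar>) + \<eta>" if i: "i \<in> I" for i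
    proof -
      have "\<exists>s\<in>var_sums f (u i) (v i). variation f (u i) (v i) - \<eta> < s"
        using uv[OF i] eta var_sums_nonempty[of "u i" "v i" f] unfolding variation_def
        by (intro less_cSupD) auto
      then obtain J :: "nat set" and p q where "subintervals J p q (u i) (v i)"
        "variation f (u i) (v i) - \<eta> < (\<Sum>j\<in>J. \<bar>f (q j) - f (p j)\<bar>)"
        unfolding var_sums_def by blast
      then show ?thesis by (intro exI[of _ J] exI[of _ p] exI[of _ q]) linarith
    qed
    then obtain J p q where J: "\<And>i. i \<in> I \<Longrightarrow> subintervals (J i :: nat set) (p i) (q i) (u i) (v i)"
      and Jv: "\<And>i. i \<in> I \<Longrightarrow> variation f (u i) (v i) < (\<Sum>j\<in>J i. \<bar>f (q i j) - f (p i j)\<bar>) + \<eta>"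
      by metis
    have finJ: "\<And>i. i \<in> I \<Longrightarrow> finite (J i)" using J unfolding subintervals_def by auto
    have "subintervals (Sigma I J) (\<lambda>(i,j). p i j) (\<lambda>(i,j). q i j) a b"
      unfolding subintervals_def
    proof (intro conjI)
      show "finite (Sigma I J)" using fin finJ by auto
      show "\<forall>i\<in>Sigma I J. a \<le> (case i of (i, j) \<Rightarrow> p i j) \<and> (case i of (i, j) \<Rightarrow> p i j) \<le> (case i of (i, j) \<Rightarrow> q i j)
          \<and> (case i of (i, j) \<Rightarrow> q i j) \<le> b"
        using J uv unfolding subintervals_def by force
      show "disjoint_family_on (\<lambda>i. {(case i of (i, j) \<Rightarrow> p i j)<..<(case i of (i, j) \<Rightarrow> q i j)}) (Sigma I J)"
        unfolding disjoint_family_on_def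
      proof (intro ballI impI)
        fix z w assume zw: "z \<in> Sigma I J" "w \<in> Sigma I J" "z \<noteq> w"
        obtain i j where z: "z = (i, j)" by (cases z)
        obtain i' j' where w: "w = (i', j')" by (cases w)
        have I: "i \<in> I" "i' \<in> I" "j \<in> J i" "j' \<in> J i'" using zw z w by auto
        have "x \<notin> {p i' j'<..<q i' j'}" if x: "x \<in> {p i j<..<q i j}" for x
        proof
          assume x': "x \<in> {p i' j'<..<q i' j'}"
          have "x \<in> {u i<..<v i}" "x \<in> {u i'<..<v i'}"
            using x x' I J[of i] J[of i'] unfolding subintervals_def by force+
          then have "i = i'" using s I unfolding subintervals_def disjoint_family_on_def by blast
          moreover have "j \<noteq> j'" using calculation zw z w by auto
          ultimately show False
            using x x' I J[of i] unfolding subintervals_def disjoint_family_on_def by blast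
        qed
        then show "{(case z of (i, j) \<Rightarrow> p i j)<..<(case z of (i, j) \<Rightarrow> q i j)} \<inter>
            {(case w of (i, j) \<Rightarrow> p i j)<..<(case w of (i, j) \<Rightarrow> q i j)} = {}"
          unfolding z w prod.case by blast
      qed
    qed
    moreover have "(\<Sum>i\<in>Sigma I J. (case i of (i, j) \<Rightarrow> q i j) - (case i of (i, j) \<Rightarrow> p i j)) < \<delta>"
    proof -
      have "(\<Sum>i\<in>Sigma I J. (case i of (i, j) \<Rightarrow> q i j) - (case i of (i, j) \<Rightarrow> p i j))
          = (\<Sum>i\<in>I. \<Sum>j\<in>J i. q i j - p i j)"
        using fin finJ by (subst sum.Sigma) (auto intro: sum.cong)
      also have "\<dots> \<le> (\<Sum>i\<in>I. v i - u i)"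
        using J uv by (intro sum_mono subintervals_length) auto
      finally show ?thesis using len by simp
    qed
    ultimately have "(\<Sum>i\<in>Sigma I J. \<bar>f (case i of (i, j) \<Rightarrow> q i j) - f (case i of (i, j) \<Rightarrow> p i j)\<bar>) < \<epsilon> / 2"
      by (rule \<delta>(2))
    moreover have "(\<Sum>i\<in>Sigma I J. \<bar>f (case i of (i, j) \<Rightarrow> q i j) - f (case i of (i, j) \<Rightarrow> p i j)\<bar>)
        = (\<Sum>i\<in>I. \<Sum>j\<in>J i. \<bar>f (q i j) - f (p i j)\<bar>)"
      using fin finJ by (subst sum.Sigma) (auto intro: sum.cong)
    ultimately have small: "(\<Sum>i\<in>I. \<Sum>j\<in>J i. \<bar>f (q i j) - f (p i j)\<bar>) < \<epsilon> / 2" by simp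
    have "(\<Sum>i\<in>I. \<bar>variation f a (v i) - variation f a (u i)\<bar>) \<le> (\<Sum>i\<in>I. (\<Sum>j\<in>J i. \<bar>f (q i j) - f (p i j)\<bar>) + \<eta>)"
    proof (rule sum_mono)
      fix i assume i: "i \<in> I"
      show "\<bar>variation f a (v i) - variation f a (u i)\<bar> \<le> (\<Sum>j\<in>J i. \<bar>f (q i j) - f (p i j)\<bar>) + \<eta>"
        using variation_subadd[of a "u i" "v i"] variation_increment[of a "u i" "v i"] uv[OF i] Jv[OF i]
        by linarith
    qed
    also have "\<dots> = (\<Sum>i\<in>I. \<Sum>j\<in>J i. \<bar>f (q i j) - f (p i j)\<bar>) + card I * \<eta>"
      by (simp add: sum.distrib)
    also have "card I * \<eta> \<le> \<epsilon> / 2" unfolding \<eta>_def using e by (simp add: field_simps)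
    finally show "(\<Sum>i\<in>I. \<bar>variation f a (v i) - variation f a (u i)\<bar>) < \<epsilon>" using small by simp
  qed
qed

end

section \<open>Closure properties of absolute continuity\<close>

lemma abs_cont_add:
  assumes "abs_cont f a b" "abs_cont g a b"
  shows "abs_cont (\<lambda>x. f x + g x) a b"
  unfolding abs_cont_def
proof (intro allI impI)
  fix \<epsilon> :: real assume e: "\<epsilon> > 0"
  obtain \<delta> where \<delta>: "\<delta> > 0" "\<And>(I::nat set) u v. subintervals I u v a b \<Longrightarrow> (\<Sum>i\<in>I. v i - u i) < \<delta> \<Longrightarrow>
      (\<Sum>i\<in>I. \<bar>f (v i) - f (u i)\<bar>) < \<epsilon> / 2"
    using abs_contE[OF assms(1) half_gt_zero[OF e]] by blast
  obtain \<delta>' where \<delta>': "\<delta>' > 0" "\<And>(I::nat set) u v. subintervals I u v a b \<Longrightarrow> (\<Sum>i\<in>I. v i - u i) < \<delta>' \<Longrightarrow>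
      (\<Sum>i\<in>I. \<bar>g (v i) - g (u i)\<bar>) < \<epsilon> / 2"
    using abs_contE[OF assms(2) half_gt_zero[OF e]] by blast
  show "\<exists>\<delta>>0. \<forall>(I::nat set) u v. subintervals I u v a b \<and> (\<Sum>i\<in>I. v i - u i) < \<delta>
     \<longrightarrow> (\<Sum>i\<in>I. \<bar>f (v i) + g (v i) - (f (u i) + g (u i))\<bar>) < \<epsilon>"
  proof (intro exI[of _ "min \<delta> \<delta>'"] conjI allI impI; (elim conjE)?)
    show "0 < min \<delta> \<delta>'" using \<delta>(1) \<delta>'(1) by simp
    fix I :: "nat set" and u v
    assume H: "subintervals I u v a b" "(\<Sum>i\<in>I. v i - u i) < min \<delta> \<delta>'"
    have "(\<Sum>i\<in>I. \<bar>f (v i) + g (v i) - (f (u i) + g (u i))\<bar>) \<le>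
      (\<Sum>i\<in>I. \<bar>f (v i) - f (u i)\<bar> + \<bar>g (v i) - g (u i)\<bar>)"
      by (intro sum_mono) auto
    also have "\<dots> < \<epsilon>" using \<delta>(2)[OF H(1)] \<delta>'(2)[OF H(1)] H(2) by (simp add: sum.distrib)
    finally show "(\<Sum>i\<in>I. \<bar>f (v i) + g (v i) - (f (u i) + g (u i))\<bar>) < \<epsilon>" .
  qed
qed

lemma abs_cont_continuous:
  assumes "abs_cont f a b" shows "continuous_on {a..b} f"
  unfolding continuous_on_iff
proof (intro ballI allI impI)
  fix x \<epsilon> :: real assume x: "x \<in> {a..b}" and e: "\<epsilon> > 0"
  obtain \<delta> where \<delta>: "\<delta> > 0" "\<And>(I::nat set) u v. subintervals I u v a b \<Longrightarrow> (\<Sum>i\<in>I. v i - u i) < \<delta> \<Longrightarrow>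
      (\<Sum>i\<in>I. \<bar>f (v i) - f (u i)\<bar>) < \<epsilon>"
    using abs_contE[OF assms(1) e] by blast
  have *: "\<bar>f y - f x\<bar> < \<epsilon>" if "x \<in> {a..b}" "y \<in> {a..b}" "x \<le> y" "y - x < \<delta>" for x y
    using \<delta>(2)[OF subintervals_mono[OF subintervals_singleton, of x y]] that by simp
  show "\<exists>d>0. \<forall>x'\<in>{a..b}. dist x' x < d \<longrightarrow> dist (f x') (f x) < \<epsilon>"
  proof (intro exI[of _ \<delta>] conjI \<delta>(1) ballI impI)
    fix y assume "y \<in> {a..b}" "dist y x < \<delta>"
    then show "dist (f y) (f x) < \<epsilon>"
      using *[of x y] *[of y x] x by (cases "x \<le> y") (auto simp: dist_real_def)
  qed
qed

lemma continuous_on_Icc_bounded: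
  fixes f :: "real \<Rightarrow> real"
  assumes "continuous_on {a..b} f"
  obtains B where "\<And>x. x \<in> {a..b} \<Longrightarrow> \<bar>f x\<bar> \<le> B"
  using compact_imp_bounded[OF compact_continuous_image[OF assms compact_Icc]]
  unfolding bounded_iff by (auto simp del: atLeastAtMost_iff)

text \<open>Differences, products and continuously differentiable functions all reduce to this
  comparison of increments.\<close>

lemma abs_cont_dominated:
  assumes "abs_cont f a b" "abs_cont g a b"
    and "\<And>x y. x \<in> {a..b} \<Longrightarrow> y \<in> {a..b} \<Longrightarrow> \<bar>h y - h x\<bar> \<le> M * (\<bar>f y - f x\<bar> + \<bar>g y - g x\<bar>)"
  shows "abs_cont h a b"
  unfolding abs_cont_def
proof (intro allI impI)
  fix \<epsilon> :: real assume e: "\<epsilon> > 0"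
  define \<eta> where "\<eta> = \<epsilon> / (2 * (\<bar>M\<bar> + 1))"
  have eta: "\<eta> > 0" unfolding \<eta>_def using e by simp
  obtain \<delta> where \<delta>: "\<delta> > 0" "\<And>(I::nat set) u v. subintervals I u v a b \<Longrightarrow> (\<Sum>i\<in>I. v i - u i) < \<delta> \<Longrightarrow>
      (\<Sum>i\<in>I. \<bar>f (v i) - f (u i)\<bar>) < \<eta>"
    using abs_contE[OF assms(1) eta] by blast
  obtain \<delta>' where \<delta>': "\<delta>' > 0" "\<And>(I::nat set) u v. subintervals I u v a b \<Longrightarrow> (\<Sum>i\<in>I. v i - u i) < \<delta>' \<Longrightarrow>
      (\<Sum>i\<in>I. \<bar>g (v i) - g (u i)\<bar>) < \<eta>"
    using abs_contE[OF assms(2) eta] by blast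
  show "\<exists>\<delta>>0. \<forall>(I::nat set) u v. subintervals I u v a b \<and> (\<Sum>i\<in>I. v i - u i) < \<delta>
     \<longrightarrow> (\<Sum>i\<in>I. \<bar>h (v i) - h (u i)\<bar>) < \<epsilon>"
  proof (intro exI[of _ "min \<delta> \<delta>'"] conjI allI impI; (elim conjE)?)
    show "0 < min \<delta> \<delta>'" using \<delta>(1) \<delta>'(1) by simp
    fix I :: "nat set" and u v
    assume H: "subintervals I u v a b" "(\<Sum>i\<in>I. v i - u i) < min \<delta> \<delta>'"
    have "(\<Sum>i\<in>I. \<bar>h (v i) - h (u i)\<bar>) \<le> (\<Sum>i\<in>I. M * (\<bar>f (v i) - f (u i)\<bar> + \<bar>g (v i) - g (u i)\<bar>))"
      using H(1) unfolding subintervals_def by (intro sum_mono assms(3)) force+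
    also have "\<dots> = M * ((\<Sum>i\<in>I. \<bar>f (v i) - f (u i)\<bar>) + (\<Sum>i\<in>I. \<bar>g (v i) - g (u i)\<bar>))"
      by (simp add: sum_distrib_left[symmetric] sum.distrib)
    also have "\<dots> \<le> (\<bar>M\<bar> + 1) * ((\<Sum>i\<in>I. \<bar>f (v i) - f (u i)\<bar>) + (\<Sum>i\<in>I. \<bar>g (v i) - g (u i)\<bar>))"
      by (intro mult_right_mono add_nonneg_nonneg sum_nonneg) auto
    also have "\<dots> < (\<bar>M\<bar> + 1) * (\<eta> + \<eta>)"
      using \<delta>(2)[OF H(1)] \<delta>'(2)[OF H(1)] H(2) by (intro mult_strict_left_mono) auto
    also have "\<dots> = \<epsilon>"
      using abs_ge_zero[of M] unfolding \<eta>_def by (simp add: nonzero_divide_eq_eq add_divide_distrib[symmetric] del: abs_ge_zero)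
    finally show "(\<Sum>i\<in>I. \<bar>h (v i) - h (u i)\<bar>) < \<epsilon>" .
  qed
qed

lemma abs_cont_diff:
  assumes "abs_cont f a b" "abs_cont g a b"
  shows "abs_cont (\<lambda>x. f x - g x) a b"
  by (rule abs_cont_dominated[OF assms, of _ 1]) auto

lemma abs_cont_mult:
  assumes "abs_cont f a b" "abs_cont g a b"
  shows "abs_cont (\<lambda>x. f x * g x) a b"
proof -
  obtain B where B: "\<And>x. x \<in> {a..b} \<Longrightarrow> \<bar>f x\<bar> \<le> B"
    using continuous_on_Icc_bounded[OF abs_cont_continuous[OF assms(1)]] by blast
  obtain C where C: "\<And>x. x \<in> {a..b} \<Longrightarrow> \<bar>g x\<bar> \<le> C"
    using continuous_on_Icc_bounded[OF abs_cont_continuous[OF assms(2)]] by blast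
  show ?thesis
  proof (rule abs_cont_dominated[OF assms])
    fix x y assume xy: "x \<in> {a..b}" "y \<in> {a..b}"
    have "\<bar>f y * g y - f x * g x\<bar> = \<bar>(f y - f x) * g y + f x * (g y - g x)\<bar>"
      by (simp add: algebra_simps)
    also have "\<dots> \<le> \<bar>f y - f x\<bar> * \<bar>g y\<bar> + \<bar>f x\<bar> * \<bar>g y - g x\<bar>"
      by (metis abs_triangle_ineq abs_mult)
    also have "\<dots> \<le> \<bar>f y - f x\<bar> * max B C + max B C * \<bar>g y - g x\<bar>"
      using B[OF xy(1)] C[OF xy(2)] by (intro add_mono mult_left_mono mult_right_mono) auto
    finally show "\<bar>f y * g y - f x * g x\<bar> \<le> max B C * (\<bar>f y - f x\<bar> + \<bar>g y - g x\<bar>)"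
      by (simp add: algebra_simps)
  qed
qed

lemma abs_cont_C1:
  assumes "\<And>x. x \<in> {a..b} \<Longrightarrow> (f has_real_derivative f' x) (at x)" "continuous_on {a..b} f'"
  shows "abs_cont f a b"
proof -
  have id: "abs_cont (\<lambda>x. x) a b"
    unfolding abs_cont_def
  proof (intro allI impI)
    fix \<epsilon> :: real assume "\<epsilon> > 0"
    then show "\<exists>\<delta>>0. \<forall>(I::nat set) u v. subintervals I u v a b \<and> (\<Sum>i\<in>I. v i - u i) < \<delta>
      \<longrightarrow> (\<Sum>i\<in>I. \<bar>v i - u i\<bar>) < \<epsilon>"
      by (intro exI[of _ \<epsilon>]) (auto simp: subintervals_def)
  qed
  obtain B where B: "\<And>x. x \<in> {a..b} \<Longrightarrow> \<bar>f' x\<bar> \<le> B"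
    using continuous_on_Icc_bounded[OF assms(2)] by blast
  show ?thesis
  proof (rule abs_cont_dominated[OF id id, of _ B])
    fix x y assume xy: "x \<in> {a..b}" "y \<in> {a..b}"
    have "norm (f y - f x) \<le> B * norm (y - x)"
      using xy B by (intro field_differentiable_bound[of "{a..b}" f f'])
        (auto intro: assms(1) has_field_derivative_at_within simp del: atLeastAtMost_iff)
    moreover have "B \<ge> 0" using B[OF xy(1)] by linarith
    then have "B * \<bar>y - x\<bar> \<ge> 0" by simp
    ultimately show "\<bar>f y - f x\<bar> \<le> B * (\<bar>y - x\<bar> + \<bar>y - x\<bar>)"
      unfolding distrib_left real_norm_def by linarith
  qed
qed

section \<open>Stieltjes measures of nondecreasing absolutely continuous functions\<close>

lemma abs_cont_clamp:
  assumes ac: "abs_cont F a b" and "a \<le> b" "c \<le> b"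
  shows "abs_cont (\<lambda>x. F (max (min x b) a)) c d"
  unfolding abs_cont_def
proof (intro allI impI)
  fix \<epsilon> :: real assume e: "\<epsilon> > 0"
  obtain \<delta> where \<delta>: "\<delta> > 0" "\<And>(I::nat set) u v. subintervals I u v a b \<Longrightarrow> (\<Sum>i\<in>I. v i - u i) < \<delta> \<Longrightarrow>
      (\<Sum>i\<in>I. \<bar>F (v i) - F (u i)\<bar>) < \<epsilon>"
    using abs_contE[OF ac e] by blast
  show "\<exists>\<delta>>0. \<forall>(I::nat set) u v. subintervals I u v c d \<and> (\<Sum>i\<in>I. v i - u i) < \<delta>
     \<longrightarrow> (\<Sum>i\<in>I. \<bar>F (max (min (v i) b) a) - F (max (min (u i) b) a)\<bar>) < \<epsilon>"
  proof (intro exI[of _ \<delta>] conjI allI impI \<delta>(1); elim conjE)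
    fix I :: "nat set" and u v
    assume s: "subintervals I u v c d" and len: "(\<Sum>i\<in>I. v i - u i) < \<delta>"
    have "(\<Sum>i\<in>I. max (min (v i) b) a - max (min (u i) b) a) \<le> (\<Sum>i\<in>I. v i - u i)"
      using s unfolding subintervals_def by (intro sum_mono) (auto simp: max_def min_def)
    then show "(\<Sum>i\<in>I. \<bar>F (max (min (v i) b) a) - F (max (min (u i) b) a)\<bar>) < \<epsilon>"
      using len by (intro \<delta>(2) subintervals_max[OF subintervals_min[OF s]] assms) auto
  qed
qed

text \<open>The part of a null set in a bounded window is covered by nonoverlapping compact
  intervals inside an open set of Lebesgue measure below \<delta>. Finitely many of them have total
  length below \<delta>, hence Stieltjes measure at most \<epsilon>.\<close>

lemma interval_measure_absolutely_continuous:
  assumes mono: "\<And>x y. x \<le> y \<Longrightarrow> H x \<le> H y" and cont: "continuous_on UNIV H"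
    and ac: "\<And>m::nat. abs_cont H (- real m) (real m)"
  shows "absolutely_continuous lborel (interval_measure H)"
proof -
  let ?\<mu> = "interval_measure H"
  have null: "emeasure ?\<mu> (N \<inter> {- real m..real m}) = 0"
    if N: "N \<in> null_sets lborel" for N and m :: nat
  \<comment> \<open>\<open>covering_lemma\<close> wants a box with nonempty interior. For
    \<open>m = 0\<close> the window is a single point, which is null because \<open>H\<close> is
    continuous.\<close>
  proof (cases "m = 0 \<or> N \<inter> {- real m..real m} = {}")
    case True
    have "emeasure ?\<mu> (N \<inter> {- real m..real m}) \<le> emeasure ?\<mu> {0..0}" if "m = 0"
      using that by (intro emeasure_mono) auto
    also have "\<dots> = 0" by (subst emeasure_interval_measure_Icc) (auto intro: mono cont)
    finally show ?thesis using True by auto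
  next
    case False
    have le: "emeasure ?\<mu> (N \<inter> {- real m..real m}) \<le> 0 + ennreal \<epsilon>" if e: "\<epsilon> > 0" for \<epsilon>
    proof -
      let ?S = "N \<inter> {- real m..real m}"
      obtain \<delta> where \<delta>: "\<delta> > 0" "\<And>(I::real set set) u v. subintervals I u v (- real m) (real m) \<Longrightarrow> (\<Sum>i\<in>I. v i - u i) < \<delta> \<Longrightarrow>
        (\<Sum>i\<in>I. \<bar>H (v i) - H (u i)\<bar>) < \<epsilon>"
        using abs_contE[OF ac e] by blast
      obtain U where U: "open U" "N \<subseteq> U" "emeasure lborel (U - N) < ennreal \<delta>"
        using outer_regular_lborel[of N \<delta>] null_setsD2[OF N] \<delta>(1) by (metis sets_lborel)
      have Um: "emeasure lborel U < ennreal \<delta>"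
        using U N by (simp add: emeasure_Diff_null_set open_Collect_neq)
      \<comment> \<open>The covering intervals are subordinate to this gauge and each contains a
        point of \<open>N\<close>, so each lies inside \<open>U\<close>.\<close>
      have g: "gauge (\<lambda>x. if x \<in> U then U else UNIV)" using U(1) unfolding gauge_def by auto
      have "?S \<subseteq> cbox (- real m) (real m)" "box (- real m) (real m) \<noteq> {}"
        using False by auto
      from covering_lemma[OF this g] obtain D where D: "countable D" "\<Union>D \<subseteq> cbox (- real m) (real m)"
        "\<And>K. K \<in> D \<Longrightarrow> interior K \<noteq> {} \<and> (\<exists>c d. K = cbox c d)"
        "pairwise (\<lambda>A B. interior A \<inter> interior B = {}) D"
        "\<And>K. K \<in> D \<Longrightarrow> \<exists>x \<in> ?S \<inter> K. K \<subseteq> (if x \<in> U then U else UNIV)" "?S \<subseteq> \<Union>D"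
        by (metis (no_types, lifting))
      have K: "Inf K < Sup K \<and> K = {Inf K..Sup K}" if "K \<in> D" for K
        using D(3)[OF that] by auto
      have KU: "K \<subseteq> U" if "K \<in> D" for K
      proof -
        from D(5)[OF that] obtain x where "x \<in> ?S \<inter> K" "K \<subseteq> (if x \<in> U then U else UNIV)" by blast
        moreover have "x \<in> U" using calculation(1) U(2) by blast
        ultimately show ?thesis by simp
      qed
      have int: "interior K = {Inf K<..<Sup K}" if "K \<in> D" for K
        using K[OF that] by (metis interior_atLeastAtMost_real)
      have fin: "emeasure ?\<mu> (\<Union>E) \<le> ennreal \<epsilon>" if E: "E \<subseteq> D" "finite E" for E
      proof -
        have sub: "subintervals E Inf Sup (- real m) (real m)"
          unfolding subintervals_def
        proof (intro conjI ballI)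
          show "finite E" by fact
          show "disjoint_family_on (\<lambda>i. {Inf i<..<Sup i}) E"
            using D(4) E(1) int unfolding disjoint_family_on_def pairwise_def by (metis subsetD)
          fix i assume "i \<in> E"
          then have i: "i \<in> D" using E by auto
          from K[OF i] have "Inf i \<in> i" "Sup i \<in> i" by (metis atLeastAtMost_iff order.refl less_imp_le)+
          with D(2) i have "Inf i \<in> cbox (- real m) (real m)" "Sup i \<in> cbox (- real m) (real m)" by blast+
          then show "- real m \<le> Inf i" "Sup i \<le> real m" by auto
          show "Inf i \<le> Sup i" using K[OF i] by simp
        qed
        have "ennreal (\<Sum>i\<in>E. Sup i - Inf i) = (\<Sum>i\<in>E. emeasure lborel {Inf i<..<Sup i})"
          using sub unfolding subintervals_def by (subst sum_ennreal[symmetric]) (auto intro!: sum.cong)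
        also have "\<dots> = emeasure lborel (\<Union>i\<in>E. {Inf i<..<Sup i})"
          using sub unfolding subintervals_def by (intro sum_emeasure) auto
        also have "\<dots> \<le> emeasure lborel U"
          using U(1) E K KU by (intro emeasure_mono) (force, simp)
        also note Um
        finally have "(\<Sum>i\<in>E. Sup i - Inf i) < \<delta>" by (metis ennreal_leI not_le)
        from \<delta>(2)[OF sub this] have small: "(\<Sum>i\<in>E. \<bar>H (Sup i) - H (Inf i)\<bar>) < \<epsilon>" .
        have EU: "\<Union>E = (\<Union>i\<in>E. {Inf i..Sup i})"
        proof -
          have "{Inf i..Sup i} = i" if "i \<in> E" for i using K E(1) that by blast
          then show ?thesis by simp
        qed
        have "emeasure ?\<mu> (\<Union>i\<in>E. {Inf i..Sup i}) \<le> (\<Sum>i\<in>E. emeasure ?\<mu> {Inf i..Sup i})"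
          using E by (intro emeasure_subadditive_finite) auto
        also have "\<dots> = (\<Sum>i\<in>E. ennreal \<bar>H (Sup i) - H (Inf i)\<bar>)"
          using sub mono unfolding subintervals_def
          by (intro sum.cong refl) (subst emeasure_interval_measure_Icc, auto intro: cont)
        also have "\<dots> = ennreal (\<Sum>i\<in>E. \<bar>H (Sup i) - H (Inf i)\<bar>)" by (rule sum_ennreal) simp
        also have "\<dots> \<le> ennreal \<epsilon>" using small by (intro ennreal_leI) simp
        finally show ?thesis unfolding EU .
      qed
      have Dne: "D \<noteq> {}" using D(6) False by auto
      \<comment> \<open>Absolute continuity controls finite selections only, so the countable cover
        is exhausted by increasing finite unions.\<close>
      define A where "A n = \<Union>(from_nat_into D ` {..n})" for n :: nat
      have Asub: "from_nat_into D ` {..n} \<subseteq> D" for n using from_nat_into[OF Dne] by auto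
      have AD: "(\<Union>n. A n) = \<Union>D"
      proof -
        have "(\<Union>n. A n) = \<Union>(range (from_nat_into D))" unfolding A_def by auto
        then show ?thesis using range_from_nat_into[OF Dne D(1)] by simp
      qed
      have Am: "range A \<subseteq> sets ?\<mu>"
      proof -
        have "closed K" if "K \<in> D" for K using D(3)[OF that] by auto
        then have "A n \<in> sets ?\<mu>" for n
          unfolding A_def using Asub[of n] by (intro sets.finite_Union) auto
        then show ?thesis by auto
      qed
      have "emeasure ?\<mu> ?S \<le> emeasure ?\<mu> (\<Union>n. A n)"
        using D(6) Am unfolding AD[symmetric] by (intro emeasure_mono) auto
      also have "\<dots> = (SUP n. emeasure ?\<mu> (A n))"
        using Am by (intro SUP_emeasure_incseq[symmetric] monoI) (simp_all add: A_def Union_mono image_mono)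
      also have "\<dots> \<le> ennreal \<epsilon>"
        unfolding A_def using fin Asub by (intro SUP_least) auto
      finally show ?thesis by simp
    qed
    have "emeasure ?\<mu> (N \<inter> {- real m..real m}) \<le> 0" by (rule ennreal_le_epsilon) (rule le)
    then show ?thesis by simp
  qed
  show ?thesis
    unfolding absolutely_continuous_def
  proof
    fix N :: "real set" assume N: "N \<in> null_sets lborel"
    have "N = (\<Union>m. N \<inter> {- real m..real m})"
    proof -
      have "x \<in> {- real (nat \<lceil>\<bar>x\<bar>\<rceil>)..real (nat \<lceil>\<bar>x\<bar>\<rceil>)}" for x
        using le_of_int_ceiling[of "\<bar>x\<bar>"] by simp linarith
      then show ?thesis by blast
    qed
    moreover have "(\<Union>m. N \<inter> {- real m..real m}) \<in> null_sets ?\<mu>"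
      using null_setsD2[OF N] null[OF N] by (intro null_sets_UN null_setsI) (simp_all del: sets_lborel)
    ultimately show "N \<in> null_sets ?\<mu>" by simp
  qed
qed

lemma abs_cont_mono_density:
  assumes ac: "abs_cont F a b" and mono: "\<And>x y. a \<le> x \<Longrightarrow> x \<le> y \<Longrightarrow> y \<le> b \<Longrightarrow> F x \<le> F y" and ab: "a \<le> b"
  obtains \<phi> where "\<And>x. x \<in> {a..b} \<Longrightarrow> (\<phi> has_integral F x - F a) {a..x}"
proof -
  \<comment> \<open>A Stieltjes measure comes from a function on the whole line, so \<open>F\<close>
    is continued by constants outside [a, b].\<close>
  define H where "H = (\<lambda>x. F (max (min x b) a))"
  have Hmono: "H x \<le> H y" if "x \<le> y" for x y
    unfolding H_def using that ab by (intro mono) auto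
  have Hcont: "continuous_on UNIV H"
    unfolding H_def
    by (rule continuous_on_compose2[OF abs_cont_continuous[OF ac]]) (use ab in \<open>auto intro!: continuous_intros\<close>)
  have Hac: "abs_cont H c d" for c d
  proof -
    have "abs_cont H (min c b) d" unfolding H_def by (rule abs_cont_clamp[OF ac ab]) simp
    then show ?thesis by (rule abs_cont_subset) auto
  qed
  have "absolutely_continuous lborel (interval_measure H)"
    by (rule interval_measure_absolutely_continuous[OF Hmono Hcont Hac])
  then obtain f where f[measurable]: "f \<in> borel_measurable lborel" and dens: "density lborel f = interval_measure H"
    using sigma_finite_measure.Radon_Nikodym[OF sigma_finite_lborel, of "interval_measure H"] by auto
  have int: "(\<integral>\<^sup>+y. f y * indicator {a..x} y \<partial>lborel) = ennreal (F x - F a)" if x: "x \<in> {a..b}" for x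
  proof -
    have "(\<integral>\<^sup>+y. f y * indicator {a..x} y \<partial>lborel) = emeasure (density lborel f) {a..x}"
      by (subst emeasure_density) auto
    also have "\<dots> = ennreal (H x - H a)"
      unfolding dens using x by (intro emeasure_interval_measure_Icc Hmono Hcont) auto
    also have "H x - H a = F x - F a" using x by (simp add: H_def min_absorb1 max_absorb1)
    finally show ?thesis .
  qed
  \<comment> \<open>The Radon-Nikodym density may take the value \<infinity>. Finite mass on [a, b]
    confines this to a null set, so \<open>enn2real\<close> leaves the integrals unchanged.\<close>
  have "AE y in lborel. f y * indicator {a..b} y \<noteq> \<infinity>"
    using int[of b] ab by (intro nn_integral_PInf_AE) auto
  then have fin: "AE y in lborel. y \<in> {a..b} \<longrightarrow> ennreal (enn2real (f y)) = f y"
    by eventually_elim (auto simp: less_top)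
  show thesis
  proof (rule that[of "\<lambda>y. enn2real (f y)"])
    fix x assume x: "x \<in> {a..b}"
    have "(\<integral>\<^sup>+y. ennreal (enn2real (f y) * indicator {a..x} y) \<partial>lborel) = (\<integral>\<^sup>+y. f y * indicator {a..x} y \<partial>lborel)"
      using fin x by (intro nn_integral_cong_AE) (auto elim!: eventually_mono split: split_indicator)
    then have "((\<lambda>y. enn2real (f y) * indicator {a..x} y) has_integral F x - F a) UNIV"
      using int[OF x] mono[of a x] x
      by (intro nn_integral_has_integral) (auto intro!: mult_nonneg_nonneg)
    then have "((\<lambda>y. if y \<in> {a..x} then enn2real (f y) else 0) has_integral F x - F a) UNIV"
      by (rule has_integral_eq[rotated]) (auto split: split_indicator)
    then show "((\<lambda>y. enn2real (f y)) has_integral F x - F a) {a..x}"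
      by (subst (asm) has_integral_restrict_UNIV)
  qed
qed

lemma abs_cont_imp_indefinite_integral:
  assumes ac: "abs_cont f a b" and ab: "a \<le> b"
  obtains \<phi> where "\<And>x. x \<in> {a..b} \<Longrightarrow> (\<phi> has_integral f x - f a) {a..x}"
proof -
  let ?V = "variation f a"
  note V = abs_cont_variation[OF ac]
  have incr: "?V x + \<bar>f y - f x\<bar> \<le> ?V y" if "a \<le> x" "x \<le> y" "y \<le> b" for x y
    using variation_increment[OF ac order.refl that] .
  have mono: "?V x \<le> ?V y" "?V x - f x \<le> ?V y - f y" if "a \<le> x" "x \<le> y" "y \<le> b" for x y
    using incr[OF that] by linarith+
  obtain \<phi> where \<phi>: "\<And>x. x \<in> {a..b} \<Longrightarrow> (\<phi> has_integral ?V x - ?V a) {a..x}"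
    using abs_cont_mono_density[OF V mono(1) ab] by blast
  obtain \<psi> where \<psi>: "\<And>x. x \<in> {a..b} \<Longrightarrow> (\<psi> has_integral (?V x - f x) - (?V a - f a)) {a..x}"
    using abs_cont_mono_density[OF abs_cont_diff[OF V ac] mono(2) ab] by blast
  show thesis
  proof (rule that)
    fix x assume "x \<in> {a..b}"
    from has_integral_diff[OF \<phi>[OF this] \<psi>[OF this]]
    show "((\<lambda>x. \<phi> x - \<psi> x) has_integral f x - f a) {a..x}" by simp
  qed
qed

section \<open>Almost everywhere derivatives and the fundamental theorem of calculus\<close>

lemma indefinite_integral_has_derivative_ae:
  fixes \<phi> F :: "real \<Rightarrow> real"
  assumes F: "\<And>x. x \<in> {a..b} \<Longrightarrow> (\<phi> has_integral F x - F a) {a..x}"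
  obtains N where "negligible N" "\<And>x. x \<in> {a<..<b} - N \<Longrightarrow> (F has_real_derivative \<phi> x) (at x)"
proof (cases "a < b")
  case False
  then show thesis using that[of "{}"] by auto
next
  case True
  \<comment> \<open>Extension by zero gives integrability over every interval, as the
    differentiation theorem requires.\<close>
  define \<psi> where "\<psi> = (\<lambda>x. if x \<in> {a..b} then \<phi> x else 0)"
  have "\<phi> integrable_on {a..b}" using F[of b] True by (intro has_integral_integrable[of \<phi> "F b - F a"]) auto
  then have "\<psi> integrable_on UNIV" unfolding \<psi>_def by (simp only: integrable_restrict_UNIV)
  then have \<psi>: "\<psi> integrable_on cbox c d" for c d by (rule integrable_on_subcbox) simp
  have incr: "integral {x..y} \<psi> = F y - F x" if "a \<le> x" "x \<le> y" "y \<le> b" for x y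
  proof -
    have "integral {x..y} \<psi> = integral {x..y} \<phi>"
      using that unfolding \<psi>_def by (intro integral_cong) auto
    moreover have "integral {a..x} \<phi> + integral {x..y} \<phi> = integral {a..y} \<phi>"
      using that F[of y] by (intro Henstock_Kurzweil_Integration.integral_combine) auto
    ultimately show ?thesis using F[of x] F[of y] that by (auto simp: integral_unique)
  qed
  obtain N1 where N1: "negligible N1" "\<And>x e. x \<notin> N1 \<Longrightarrow> 0 < e \<Longrightarrow>
      \<exists>d>0. \<forall>h. 0 < h \<and> h < d \<longrightarrow> norm (integral (cbox x (x + h *\<^sub>R One)) \<psi> /\<^sub>R h ^ DIM(real) - \<psi> x) < e"
    using integrable_ccontinuous_explicit[OF \<psi>] by metis
  \<comment> \<open>The differentiation theorem treats forward averages over [x, x + h]; applied to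
    the reflected function it yields the backward difference quotients.\<close>
  have \<psi>': "(\<lambda>x. \<psi> (- x)) integrable_on cbox c d" for c d
    using \<psi>[of "-d" "-c"] Henstock_Kurzweil_Integration.has_integral_reflect_real[where f=\<psi> and a="-d" and b="-c"]
    unfolding integrable_on_def by simp
  obtain N2 where N2: "negligible N2" "\<And>x e. x \<notin> N2 \<Longrightarrow> 0 < e \<Longrightarrow>
      \<exists>d>0. \<forall>h. 0 < h \<and> h < d \<longrightarrow> norm (integral (cbox x (x + h *\<^sub>R One)) (\<lambda>x. \<psi> (- x)) /\<^sub>R h ^ DIM(real) - \<psi> (- x)) < e"
    using integrable_ccontinuous_explicit[OF \<psi>'] by metis
  have "negligible (uminus ` N2)"
    using N2(1) by (intro negligible_differentiable_image_negligible) (auto intro!: derivative_intros)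
  show thesis
  proof (rule that[of "N1 \<union> uminus ` N2"])
    show "negligible (N1 \<union> uminus ` N2)" using N1(1) \<open>negligible (uminus ` N2)\<close> by simp
    fix x assume x: "x \<in> {a<..<b} - (N1 \<union> uminus ` N2)"
    then have x1: "x \<notin> N1" and x2: "- x \<notin> N2" by (auto simp: image_iff)
    show "(F has_real_derivative \<phi> x) (at x)"
      unfolding DERIV_def LIM_eq
    proof (intro allI impI)
      fix e :: real assume e: "e > 0"
      obtain d1 where d1: "d1 > 0" "\<And>h. 0 < h \<Longrightarrow> h < d1 \<Longrightarrow> \<bar>integral {x..x+h} \<psi> / h - \<psi> x\<bar> < e"
        using N1(2)[OF x1 e] by (auto simp: divide_inverse mult.commute)
      obtain d2 where d2: "d2 > 0" "\<And>h. 0 < h \<Longrightarrow> h < d2 \<Longrightarrow> \<bar>integral {- x..- x+h} (\<lambda>x. \<psi> (- x)) / h - \<psi> x\<bar> < e"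
        using N2(2)[OF x2 e] by (auto simp: divide_inverse mult.commute)
      define d where "d = min (min d1 d2) (min (x - a) (b - x))"
      show "\<exists>s>0. \<forall>h. h \<noteq> 0 \<and> norm (h - 0) < s \<longrightarrow> norm ((F (x + h) - F x) / h - \<phi> x) < e"
      proof (intro exI[of _ d] conjI allI impI)
        show "d > 0" unfolding d_def using d1 d2 x by auto
        fix h :: real assume h: "h \<noteq> 0 \<and> norm (h - 0) < d"
        have \<psi>x: "\<psi> x = \<phi> x" using x unfolding \<psi>_def by auto
        show "norm ((F (x + h) - F x) / h - \<phi> x) < e"
        proof (cases "h > 0")
          case True
          then show ?thesis using d1(2)[of h] incr[of x "x+h"] h x \<psi>x unfolding d_def by auto
        next
          case False
          then have h': "0 < -h" "-h < d2" "a \<le> x + h" using h unfolding d_def by auto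
          have "integral {- x..- x + - h} (\<lambda>x. \<psi> (- x)) = integral {x + h..x} \<psi>"
            using Henstock_Kurzweil_Integration.integral_reflect_real[where f=\<psi>, of x "x + h"] by simp
          also have "\<dots> = F x - F (x + h)" using incr[of "x + h" x] h' x by auto
          finally show ?thesis using d2(2)[OF h'(1,2)] \<psi>x False h by (simp add: field_simps)
        qed
      qed
    qed
  qed
qed

lemma abs_cont_differentiable_ae:
  assumes "abs_cont f a b" "a \<le> b"
  obtains N f' where "negligible N" "\<And>x. x \<in> {a<..<b} - N \<Longrightarrow> (f has_real_derivative f' x) (at x)"
proof -
  obtain \<phi> where \<phi>: "\<And>x. x \<in> {a..b} \<Longrightarrow> (\<phi> has_integral f x - f a) {a..x}"
    using abs_cont_imp_indefinite_integral[OF assms] by blast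
  show thesis using indefinite_integral_has_derivative_ae[OF \<phi>] that by blast
qed

text \<open>Derivatives are unique, so any \<open>f'\<close> that is the derivative off a null set
  agrees almost everywhere with the density whose integral is \<open>f\<close>.\<close>

lemma abs_cont_has_integral:
  assumes "abs_cont f a b" "a \<le> b" "negligible N"
    and "\<And>x. x \<in> {a<..<b} - N \<Longrightarrow> (f has_real_derivative f' x) (at x)"
  shows "(f' has_integral f b - f a) {a..b}"
proof -
  obtain \<phi> where \<phi>: "\<And>x. x \<in> {a..b} \<Longrightarrow> (\<phi> has_integral f x - f a) {a..x}"
    using abs_cont_imp_indefinite_integral[OF assms(1,2)] by blast
  obtain N' where N': "negligible N'" "\<And>x. x \<in> {a<..<b} - N' \<Longrightarrow> (f has_real_derivative \<phi> x) (at x)"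
    using indefinite_integral_has_derivative_ae[OF \<phi>] by blast
  have "f' x = \<phi> x" if "x \<in> {a<..<b}" "x \<notin> N" "x \<notin> N'" for x
    using DERIV_unique[OF assms(4) N'(2)] that by auto
  then show ?thesis
    using assms(2,3) N'(1)
    by (intro has_integral_spike[OF _ _ \<phi>[of b], of "N \<union> N' \<union> {a, b}"]) auto
qed

section \<open>The energy and its boundary forms\<close>

text \<open>The numbers \<open>u0\<close>, \<open>u1\<close>, \<open>u2\<close> stand for the values
  of u, u', u'' at \<open>x\<close>. Identities between energies thus become algebra at one point,
  whether or not the derivatives exist there.\<close>

definition energy_density :: "real \<Rightarrow> real \<Rightarrow> real \<Rightarrow> real \<Rightarrow> real \<Rightarrow> real" where
  "energy_density k x u0 u1 u2 =
     (u2\<^sup>2 + 2 * k\<^sup>2 * (u0 / x\<^sup>2 - u1 / x)\<^sup>2 + (k\<^sup>2 * u0 / x\<^sup>2 - u1 / x)\<^sup>2) * x"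

definition energy_bilinear :: "real \<Rightarrow> real \<Rightarrow> real \<Rightarrow> real \<Rightarrow> real \<Rightarrow> real \<Rightarrow> real \<Rightarrow> real \<Rightarrow> real" where
  "energy_bilinear k x u0 u1 u2 v0 v1 v2 =
     (u2 * v2 + 2 * k\<^sup>2 * ((u0 / x\<^sup>2 - u1 / x) * (v0 / x\<^sup>2 - v1 / x))
       + (k\<^sup>2 * u0 / x\<^sup>2 - u1 / x) * (k\<^sup>2 * v0 / x\<^sup>2 - v1 / x)) * x"

text \<open>For \<open>c = |k|\<close> this is the least energy on \<open>(0, x)\<close> of a function with value \<open>u0\<close> and derivative \<open>u1\<close>
  at \<open>x\<close>, attained by a solution of \<open>G\<^sub>k u = 0\<close>; for \<open>c = - |k|\<close> it is minus the least energy on \<open>(x, \<infinity>)\<close>,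
  attained by a solution of \<open>R\<^sub>k u = 0\<close>.\<close>
definition boundary_form :: "real \<Rightarrow> real \<Rightarrow> real \<Rightarrow> real \<Rightarrow> real" where
  "boundary_form c x u0 u1 =
     (2 * c + 1) * u1\<^sup>2 - 2 * c * (c + 2) * u0 * u1 / x + (2 * c ^ 3 + c\<^sup>2) * u0\<^sup>2 / x\<^sup>2"

lemma energy_density_nonneg: "x \<ge> 0 \<Longrightarrow> energy_density k x u0 u1 u2 \<ge> 0"
  unfolding energy_density_def by simp

lemma energy_density_ge: "x \<ge> 0 \<Longrightarrow> x * u2\<^sup>2 \<le> energy_density k x u0 u1 u2"
  unfolding energy_density_def mult.commute[of x] by (intro mult_right_mono) auto

text \<open>With u the data and v the spline, u = (u - v) + v is expanded. The energy of v and all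
  of the energy of u - v except its second-order part are nonnegative and dropped.\<close>

lemma energy_density_split:
  assumes "x \<ge> 0"
  shows "x * (u2 - v2)\<^sup>2 + 2 * energy_bilinear k x (u0 - v0) (u1 - v1) (u2 - v2) v0 v1 v2
    \<le> energy_density k x u0 u1 u2"
proof -
  have "energy_density k x u0 u1 u2 = energy_density k x (u0 - v0) (u1 - v1) (u2 - v2)
      + 2 * energy_bilinear k x (u0 - v0) (u1 - v1) (u2 - v2) v0 v1 v2 + energy_density k x v0 v1 v2"
    unfolding energy_density_def energy_bilinear_def
    by (simp add: power2_eq_square algebra_simps diff_divide_distrib)
  then show ?thesis
    using energy_density_ge[OF assms, of "u2 - v2" k "u0 - v0" "u1 - v1"] energy_density_nonneg[OF assms, of k v0 v1 v2]
    by linarith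
qed

text \<open>The squared expression is x times G_k u for \<open>c = |k|\<close> and x times R_k u for
  \<open>c = - |k|\<close>. The coefficients of \<open>boundary_form\<close> are those that make the
  energy density minus x times this square an exact derivative.\<close>

lemma boundary_form_has_derivative:
  assumes "x > 0" "c\<^sup>2 = k\<^sup>2"
    and u: "(u has_real_derivative u' x) (at x)" and u': "(u' has_real_derivative u2) (at x)"
  shows "((\<lambda>x. boundary_form c x (u x) (u' x)) has_real_derivative
    energy_density k x (u x) (u' x) u2 - x * (u2 - (2 * c + 1) / x * u' x + c * (c + 2) / x\<^sup>2 * u x)\<^sup>2) (at x)"
proof -
  define y where "y = 1 / x"
  have xy: "x * y = 1" using assms(1) unfolding y_def by simp
  have "((\<lambda>x. (2 * c + 1) * (u' x)\<^sup>2 - 2 * c * (c + 2) * u x * u' x * (1 / x) + (2 * c ^ 3 + c\<^sup>2) * (u x)\<^sup>2 * (1 / x)\<^sup>2)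
    has_real_derivative ((2 * c + 1) * (2 * u' x * u2)
      - 2 * c * (c + 2) * (u' x * u' x * (1/x) + u x * u2 * (1/x) - u x * u' x * (1 / x)\<^sup>2)
      + (2 * c ^ 3 + c\<^sup>2) * (2 * u x * u' x * (1 / x)\<^sup>2 - 2 * (u x)\<^sup>2 * (1 / x)^3))) (at x)"
    using assms(1)
    by (auto intro!: derivative_eq_intros u u' simp: power2_eq_square power3_eq_cube field_simps)
  moreover have "(\<lambda>x. boundary_form c x (u x) (u' x)) = (\<lambda>x. (2 * c + 1) * (u' x)\<^sup>2 - 2 * c * (c + 2) * u x * u' x * (1 / x) + (2 * c ^ 3 + c\<^sup>2) * (u x)\<^sup>2 * (1 / x)\<^sup>2)"
    unfolding boundary_form_def by (simp add: power_divide)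
  moreover have "energy_density k x (u x) (u' x) u2 - x * (u2 - (2 * c + 1) / x * u' x + c * (c + 2) / x\<^sup>2 * u x)\<^sup>2
     = ((2 * c + 1) * (2 * u' x * u2)
      - 2 * c * (c + 2) * (u' x * u' x * (1/x) + u x * u2 * (1/x) - u x * u' x * (1 / x)\<^sup>2)
      + (2 * c ^ 3 + c\<^sup>2) * (2 * u x * u' x * (1 / x)\<^sup>2 - 2 * (u x)\<^sup>2 * (1 / x)^3))"
    unfolding energy_density_def assms(2)[symmetric]
    using assms(1) by (simp add: field_simps power2_eq_square power3_eq_cube)
  ultimately show ?thesis by simp
qed

lemma boundary_form_nonneg:
  assumes "c \<ge> 1" shows "boundary_form c x u0 u1 \<ge> 0"
proof -
  have "boundary_form c x u0 u1 = (c + 2) * (u1 - c * u0 / x)\<^sup>2 + (c - 1) * (u1\<^sup>2 + (c * u0 / x)\<^sup>2)"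
    unfolding boundary_form_def by (simp add: power2_eq_square power3_eq_cube algebra_simps diff_divide_distrib add_divide_distrib)
  then show ?thesis using assms by simp
qed

text \<open>The decomposition into squares used for \<open>c \<ge> 2\<close> has the coefficient
  \<open>c - 2\<close>, of the wrong sign at \<open>c = 1\<close>; there the form collapses to minus
  a single square.\<close>

lemma boundary_form_neg_nonpos:
  assumes "c = 1 \<or> c \<ge> 2" shows "boundary_form (- c) x u0 u1 \<le> 0"
proof (cases "c = 1")
  case True
  have "boundary_form (- 1) x u0 u1 = - (u1 - u0 / x)\<^sup>2"
    unfolding boundary_form_def by (simp add: power2_eq_square power3_eq_cube algebra_simps diff_divide_distrib add_divide_distrib)
  then show ?thesis using True by simp
next
  case False
  have "boundary_form (- c) x u0 u1 = - ((c - 2) * (u1 + c * u0 / x)\<^sup>2 + (c + 1) * (u1\<^sup>2 + (c * u0 / x)\<^sup>2))"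
    unfolding boundary_form_def by (simp add: power2_eq_square power3_eq_cube algebra_simps diff_divide_distrib add_divide_distrib)
  moreover have "(c - 2) * (u1 + c * u0 / x)\<^sup>2 \<ge> 0" "(c + 1) * (u1\<^sup>2 + (c * u0 / x)\<^sup>2) \<ge> 0"
    using False assms by auto
  ultimately show ?thesis by linarith
qed

text \<open>Because \<open>1 / x\<close> is integrable neither at \<open>0\<close> nor at \<open>\<infinity>\<close>.\<close>
lemma small_near_ends:
  fixes f :: "real \<Rightarrow> real"
  assumes int: "(\<lambda>x. f x / x) integrable_on {0<..}" and nonneg: "\<And>x. x > 0 \<Longrightarrow> f x \<ge> 0" and "\<eta> > 0" "a > 0"
  obtains \<epsilon> R where "0 < \<epsilon>" "\<epsilon> < a" "f \<epsilon> < \<eta>" "a < R" "f R < \<eta>"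
proof -
  define I where "I = integral {0<..} (\<lambda>x. f x / x)"
  \<comment> \<open>Where \<open>f\<close> stays at or above \<eta>, comparison with
    \<open>\<eta> / x\<close> bounds the logarithmic length of the interval.\<close>
  have bound: "\<eta> * (ln d - ln c) \<le> I" if cd: "0 < c" "c < d" and large: "\<And>x. c < x \<Longrightarrow> x < d \<Longrightarrow> f x \<ge> \<eta>" for c d
  proof -
    have "((\<lambda>x. \<eta> / x) has_integral \<eta> * ln d - \<eta> * ln c) {c..d}"
    proof (rule fundamental_theorem_of_calculus)
      fix x assume "x \<in> {c..d}"
      then show "((\<lambda>x. \<eta> * ln x) has_vector_derivative \<eta> / x) (at x within {c..d})"
        using cd by (auto intro!: derivative_eq_intros simp: has_real_derivative_iff_has_vector_derivative[symmetric])
    qed (use cd in simp)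
    then have "((\<lambda>x. \<eta> / x) has_integral \<eta> * ln d - \<eta> * ln c) {c<..<d}"
      by (simp add: has_integral_Icc_iff_Ioo)
    then have restr: "((\<lambda>x. if x \<in> {c<..<d} then \<eta> / x else 0) has_integral \<eta> * ln d - \<eta> * ln c) {0<..}"
      using cd by (subst has_integral_restrict) auto
    then have "\<eta> * ln d - \<eta> * ln c = integral {0<..} (\<lambda>x. if x \<in> {c<..<d} then \<eta> / x else 0)"
      by (simp add: integral_unique)
    also have "\<dots> \<le> I"
      unfolding I_def
    proof (rule integral_le[OF _ int])
      show "(\<lambda>x. if x \<in> {c<..<d} then \<eta> / x else 0) integrable_on {0<..}"
        using restr by (rule has_integral_integrable)
      fix x :: real assume "x \<in> {0<..}"
      then show "(if x \<in> {c<..<d} then \<eta> / x else 0) \<le> f x / x"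
        using large[of x] nonneg[of x] by (auto intro: divide_right_mono)
    qed
    finally show ?thesis by (simp add: algebra_simps)
  qed
  \<comment> \<open>Chosen so that \<open>\<eta> * ln T\<close> is
    \<open>\<bar>I\<bar> + \<eta>\<close>, which exceeds \<open>I\<close>; hence \<open>f\<close>
    drops below \<eta> somewhere in (a / T, a) and somewhere in (a, a * T).\<close>
  define T where "T = exp (\<bar>I\<bar> / \<eta> + 1)"
  have T: "T > 1" "\<eta> * ln T > I"
  proof -
    have "\<bar>I\<bar> / \<eta> + 1 > 0" using assms(3) by (simp add: add_nonneg_pos)
    then show "T > 1" unfolding T_def by simp
    have "\<eta> * (\<bar>I\<bar> / \<eta> + 1) = \<bar>I\<bar> + \<eta>" using assms(3) by (simp add: field_simps)
    then show "\<eta> * ln T > I" unfolding T_def using assms(3) by simp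
  qed
  have "\<exists>x. a / T < x \<and> x < a \<and> f x < \<eta>"
  proof (rule ccontr)
    assume "\<not> ?thesis"
    then have "\<eta> * (ln a - ln (a / T)) \<le> I"
      using T assms(4) by (intro bound) (force simp: not_less field_simps)+
    then show False using T assms(4) by (simp add: ln_div)
  qed
  moreover have "\<exists>x. a < x \<and> x < a * T \<and> f x < \<eta>"
  proof (rule ccontr)
    assume "\<not> ?thesis"
    then have "\<eta> * (ln (a * T) - ln a) \<le> I"
      using T assms(4) by (intro bound) (force simp: not_less field_simps)+
    then show False using T assms(4) by (simp add: ln_mult)
  qed
  moreover have "a / T > 0" using T assms(4) by simp
  ultimately show thesis using that by (meson order.strict_trans)
qed

text \<open>Made for the product of the error with \<open>M\<close>, which is controlled only
  between the knots. At the end points the zeros of \<open>f\<close> outweigh the bounded factor,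
  whatever values \<open>m\<close> takes there.\<close>

lemma continuous_on_mult_bounded:
  fixes f m :: "real \<Rightarrow> real"
  assumes f: "continuous_on {a..b} f" "f a = 0" "f b = 0"
    and m: "continuous_on {a<..<b} m" "\<And>x. x \<in> {a<..<b} \<Longrightarrow> \<bar>m x\<bar> \<le> B"
  shows "continuous_on {a..b} (\<lambda>x. f x * m x)"
  unfolding continuous_on_eq_continuous_within
proof
  fix x assume x: "x \<in> {a..b}"
  show "continuous (at x within {a..b}) (\<lambda>x. f x * m x)"
  proof (cases "x \<in> {a<..<b}")
    case True
    have "continuous_on {a<..<b} (\<lambda>x. f x * m x)"
      by (intro continuous_intros m continuous_on_subset[OF f(1)]) auto
    then have "isCont (\<lambda>x. f x * m x) x"
      using True by (simp add: continuous_on_eq_continuous_at)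
    then show ?thesis by (rule continuous_at_imp_continuous_at_within)
  next
    case False
    with x f have fx: "f x = 0" by auto
    have "((\<lambda>y. f y * m y) \<longlongrightarrow> 0) (at x within {a..b})"
    proof (rule tendsto_0_le[where K = "\<bar>B\<bar>"])
      show "(f \<longlongrightarrow> 0) (at x within {a..b})"
        using f(1) x fx unfolding continuous_on_def by fastforce
      show "\<forall>\<^sub>F y in at x within {a..b}. norm (f y * m y) \<le> norm (f y) * \<bar>B\<bar>"
        unfolding eventually_at_filter
      proof (intro always_eventually allI impI)
        fix y assume "y \<in> {a..b}"
        then have "f y = 0 \<or> \<bar>m y\<bar> \<le> \<bar>B\<bar>"
          using f m(2)[of y] by (cases "y = a \<or> y = b") force+
        then show "norm (f y * m y) \<le> norm (f y) * \<bar>B\<bar>"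
          by (auto simp: abs_mult intro: mult_left_mono)
      qed
    qed
    then show ?thesis by (simp add: continuous_within fx)
  qed
qed

text \<open>The common consequence of the two data spaces, with \<open>k\<close> in the role of |k|
  and g'' existing off \<open>N\<close>. Integrability is assumed for the boundary forms rather than
  for g and g' separately, because for |k| = 1 only g' - g / x is controlled.\<close>

locale finite_energy =
  fixes g0 g1 g2 :: "real \<Rightarrow> real" and N :: "real set" and k :: real
  assumes k: "k = 1 \<or> k \<ge> 2"
    and g0: "\<And>x. 0 < x \<Longrightarrow> (g0 has_real_derivative g1 x) (at x)"
    and g1: "\<And>a b. 0 < a \<Longrightarrow> a < b \<Longrightarrow> abs_cont g1 a b"
    and N: "negligible N"
    and g2: "\<And>x. 0 < x \<Longrightarrow> x \<notin> N \<Longrightarrow> (g1 has_real_derivative g2 x) (at x)"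
    and g2_measurable: "g2 \<in> borel_measurable (lebesgue_on {0<..})"
    and energy: "(\<lambda>x. energy_density k x (g0 x) (g1 x) (g2 x)) integrable_on {0<..}"
    and boundary: "\<And>c. c = k \<or> c = - k \<Longrightarrow> (\<lambda>x. \<bar>boundary_form c x (g0 x) (g1 x)\<bar> / x) integrable_on {0<..}"
begin

abbreviation "E \<equiv> \<lambda>x. energy_density k x (g0 x) (g1 x) (g2 x)"
abbreviation "V \<equiv> \<lambda>c x. boundary_form c x (g0 x) (g1 x)"

lemma energy_integrable: "0 < a \<Longrightarrow> E integrable_on {a..b}"
  by (rule integrable_on_subinterval[OF energy]) auto

text \<open>The derivative of \<open>V c\<close> falls short of the energy density by a weighted
  square, and \<open>V c\<close> is absolutely continuous as a polynomial in g, g' and 1 /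
  x.\<close>

lemma energy_ge_boundary_form_diff:
  assumes "0 < a" "a < b" "c = k \<or> c = - k"
  shows "V c b - V c a \<le> integral {a..b} E"
proof -
  let ?D = "\<lambda>x. E x - x * (g2 x - (2 * c + 1) / x * g1 x + c * (c + 2) / x\<^sup>2 * g0 x)\<^sup>2"
  have c1: "abs_cont g0 a b"
  proof (rule abs_cont_C1)
    show "(g0 has_real_derivative g1 x) (at x)" if "x \<in> {a..b}" for x using g0 that assms by auto
    show "continuous_on {a..b} g1" using abs_cont_continuous g1 assms by blast
  qed
  have inv: "abs_cont (\<lambda>x. 1 / x) a b"
    using assms by (intro abs_cont_C1[of _ _ _ "\<lambda>x. - 1 / x\<^sup>2"])
      (auto intro!: derivative_eq_intros continuous_intros simp: power2_eq_square field_simps)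
  have const: "abs_cont (\<lambda>x. d) a b" for d
    by (rule abs_cont_C1[of _ _ _ "\<lambda>_. 0"]) auto
  have "abs_cont (\<lambda>x. (2 * c + 1) * (g1 x * g1 x) - 2 * c * (c + 2) * (g0 x * g1 x * (1 / x))
      + (2 * c ^ 3 + c\<^sup>2) * (g0 x * g0 x * (1 / x) * (1 / x))) a b"
    by (intro abs_cont_add abs_cont_diff abs_cont_mult c1 inv const g1 assms)
  moreover have "V c x = (2 * c + 1) * (g1 x * g1 x) - 2 * c * (c + 2) * (g0 x * g1 x * (1 / x))
      + (2 * c ^ 3 + c\<^sup>2) * (g0 x * g0 x * (1 / x) * (1 / x))" for x
    unfolding boundary_form_def by (simp add: power2_eq_square)
  ultimately have "abs_cont (V c) a b" by simp
  then have V: "(?D has_integral V c b - V c a) {a..b}"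
    using assms by (intro abs_cont_has_integral[OF _ _ N] boundary_form_has_derivative g0 g2) auto
  show ?thesis
    by (rule has_integral_le[OF V integrable_integral[OF energy_integrable]]) (use assms in auto)
qed

end

text \<open>A solution of \<open>L\<^sub>k s = 0\<close> on an open interval, with \<open>s\<close>, \<open>s'\<close>, \<open>s''\<close> continuous up to the
  end points; nothing is assumed about the one-sided limits of \<open>s'''\<close> there.\<close>
locale spline_piece =
  fixes s0 s1 s2 s3 s4 :: "real \<Rightarrow> real" and a b k :: real
  assumes ab: "0 < a" "a < b"
    and s0: "\<And>x. x \<in> {a..b} \<Longrightarrow> (s0 has_real_derivative s1 x) (at x)"
    and s1: "\<And>x. x \<in> {a..b} \<Longrightarrow> (s1 has_real_derivative s2 x) (at x)"
    and s2_cont: "continuous_on {a..b} s2"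
    and s2: "\<And>x. x \<in> {a<..<b} \<Longrightarrow> (s2 has_real_derivative s3 x) (at x)"
    and s3: "\<And>x. x \<in> {a<..<b} \<Longrightarrow> (s3 has_real_derivative s4 x) (at x)"
    and ode: "\<And>x. x \<in> {a<..<b} \<Longrightarrow> x * s4 x + 2 * s3 x - (2 * k\<^sup>2 + 1) / x * s2 x
      + (2 * k\<^sup>2 + 1) / x\<^sup>2 * s1 x + (k ^ 4 - 4 * k\<^sup>2) / x ^ 3 * s0 x = 0"
begin

lemma s_cont: "continuous_on {a..b} s0" "continuous_on {a..b} s1"
  using DERIV_continuous_on s0 s1 has_field_derivative_at_within by metis+

text \<open>The coefficient of the error in the boundary terms of the energy inner product; it involves \<open>s'''\<close>.\<close>
definition "M x = - (s2 x + x * s3 x) + (2 * k\<^sup>2 + 1) * s1 x / x - 3 * k\<^sup>2 * s0 x / x\<^sup>2"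

text \<open>This is the coefficient of the error e in the energy inner product of e and s; the
  coefficient of e' is \<open>s2 x + x * s3 x + M x\<close>. The product rule therefore turns x e'
  s'' + e M into that inner product.\<close>

definition "M' x = - 3 * k\<^sup>2 * s1 x / x\<^sup>2 + (k ^ 4 + 2 * k\<^sup>2) * s0 x / x ^ 3"

text \<open>The equation removes the fourth derivative, and the third and second cancel with it:
  this is the Euler-Lagrange equation of the energy.\<close>

lemma M_derivative:
  assumes x: "x \<in> {a<..<b}"
  shows "(M has_real_derivative M' x) (at x)"
proof -
  have x0: "x > 0" using x ab by auto
  have "(M has_real_derivative (- (s3 x + (s3 x + x * s4 x)) + (2 * k\<^sup>2 + 1) * (s2 x / x - s1 x / x\<^sup>2)
      - 3 * k\<^sup>2 * (s1 x / x\<^sup>2 - 2 * s0 x / x ^ 3))) (at x)"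
    unfolding M_def
    using x x0 by (auto intro!: derivative_eq_intros s0 s1 s2 s3 simp: field_simps power2_eq_square power3_eq_cube)
  moreover have "- (s3 x + (s3 x + x * s4 x)) + (2 * k\<^sup>2 + 1) * (s2 x / x - s1 x / x\<^sup>2)
      - 3 * k\<^sup>2 * (s1 x / x\<^sup>2 - 2 * s0 x / x ^ 3) = M' x"
  proof -
    have e: "x * s4 x = - 2 * s3 x + (2 * k\<^sup>2 + 1) / x * s2 x
      - (2 * k\<^sup>2 + 1) / x\<^sup>2 * s1 x - (k ^ 4 - 4 * k\<^sup>2) / x ^ 3 * s0 x"
      using ode[OF x] by linarith
    show ?thesis unfolding M'_def e using x0 by (simp add: field_simps)
  qed
  ultimately show ?thesis by simp
qed

text \<open>The equation says that \<open>(x\<^sup>2 s''')'\<close> is a continuous function on \<open>[a, b]\<close>.\<close>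
lemma s3_bounded: obtains B where "\<And>x. x \<in> {a<..<b} \<Longrightarrow> \<bar>s3 x\<bar> \<le> B"
proof -
  define F where "F x = (2 * k\<^sup>2 + 1) * s2 x - (2 * k\<^sup>2 + 1) / x * s1 x - (k ^ 4 - 4 * k\<^sup>2) / x\<^sup>2 * s0 x" for x
  have "continuous_on {a..b} F"
    unfolding F_def using ab by (intro continuous_intros s_cont s2_cont) auto
  then obtain C where C: "\<And>x. x \<in> {a..b} \<Longrightarrow> \<bar>F x\<bar> \<le> C"
    using continuous_on_Icc_bounded by blast
  have deriv: "((\<lambda>x. x\<^sup>2 * s3 x) has_real_derivative F x) (at x)" if x: "x \<in> {a<..<b}" for x
  proof -
    have x0: "x > 0" using x ab by auto
    have "((\<lambda>x. x\<^sup>2 * s3 x) has_real_derivative x * (2 * s3 x + x * s4 x)) (at x)"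
      using x by (auto intro!: derivative_eq_intros s3 simp: power2_eq_square algebra_simps)
    moreover have "2 * s3 x + x * s4 x = (2 * k\<^sup>2 + 1) / x * s2 x
      - (2 * k\<^sup>2 + 1) / x\<^sup>2 * s1 x - (k ^ 4 - 4 * k\<^sup>2) / x ^ 3 * s0 x"
      using ode[OF x] by linarith
    moreover have "x * ((2 * k\<^sup>2 + 1) / x * s2 x - (2 * k\<^sup>2 + 1) / x\<^sup>2 * s1 x
      - (k ^ 4 - 4 * k\<^sup>2) / x ^ 3 * s0 x) = F x"
      unfolding F_def using x0 by (simp add: field_simps power2_eq_square power3_eq_cube)
    ultimately show ?thesis by simp
  qed
  define m where "m = (a + b) / 2"
  have m: "m \<in> {a<..<b}" unfolding m_def using ab by auto
  have C0: "C \<ge> 0" using C[of a] ab by auto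
  have bound: "\<bar>x\<^sup>2 * s3 x - m\<^sup>2 * s3 m\<bar> \<le> C * (b - a)" if x: "x \<in> {a<..<b}" for x
  proof -
    have "norm (x\<^sup>2 * s3 x - m\<^sup>2 * s3 m) \<le> C * norm (x - m)"
    proof (rule field_differentiable_bound[of "{a<..<b}" "\<lambda>x. x\<^sup>2 * s3 x" F])
      fix z assume z: "z \<in> {a<..<b}"
      show "((\<lambda>x. x\<^sup>2 * s3 x) has_field_derivative F z) (at z within {a<..<b})"
        using deriv[OF z] by (rule has_field_derivative_at_within)
      show "norm (F z) \<le> C" using C[of z] z by simp
    qed (use x m in auto)
    also have "\<dots> \<le> C * (b - a)" using x m C0 by (intro mult_left_mono) auto
    finally show ?thesis by simp
  qed
  show thesis
  proof (rule that)
    fix x assume x: "x \<in> {a<..<b}"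
    have "a\<^sup>2 * \<bar>s3 x\<bar> \<le> x\<^sup>2 * \<bar>s3 x\<bar>" using x ab by (intro mult_right_mono power_mono) auto
    also have "\<dots> = \<bar>x\<^sup>2 * s3 x\<bar>" by (simp add: abs_mult)
    also have "\<dots> \<le> C * (b - a) + \<bar>m\<^sup>2 * s3 m\<bar>" using bound[OF x] by linarith
    finally show "\<bar>s3 x\<bar> \<le> (C * (b - a) + \<bar>m\<^sup>2 * s3 m\<bar>) / a\<^sup>2"
      using ab by (simp add: field_simps)
  qed
qed

lemma M_bounded: obtains B where "\<And>x. x \<in> {a<..<b} \<Longrightarrow> \<bar>M x\<bar> \<le> B"
proof -
  obtain B where B: "\<And>x. x \<in> {a<..<b} \<Longrightarrow> \<bar>s3 x\<bar> \<le> B" by (rule s3_bounded) blast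
  have "continuous_on {a..b} (\<lambda>x. - s2 x + (2 * k\<^sup>2 + 1) * s1 x / x - 3 * k\<^sup>2 * s0 x / x\<^sup>2)"
    using ab by (intro continuous_intros s_cont s2_cont) auto
  then obtain C where C: "\<And>x. x \<in> {a..b} \<Longrightarrow> \<bar>- s2 x + (2 * k\<^sup>2 + 1) * s1 x / x - 3 * k\<^sup>2 * s0 x / x\<^sup>2\<bar> \<le> C"
    using continuous_on_Icc_bounded by blast
  show thesis
  proof (rule that)
    fix x assume x: "x \<in> {a<..<b}"
    have "\<bar>x * s3 x\<bar> \<le> b * B"
      unfolding abs_mult using B[OF x] x ab by (intro mult_mono) auto
    then show "\<bar>M x\<bar> \<le> C + b * B" using C[of x] x unfolding M_def by auto
  qed
qed

end

section \<open>The energy inequality between neighbouring knots\<close>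

locale interpolated_piece = finite_energy g0 g1 g2 N k + spline_piece s0 s1 s2 s3 s4 a b k
  for g0 g1 g2 :: "real \<Rightarrow> real" and N k s0 s1 s2 s3 s4 a b +
  assumes interp: "s0 a = g0 a" "s0 b = g0 b"
begin

lemma g_cont: "continuous_on {a..b} g0" "continuous_on {a..b} g1"
proof -
  show "continuous_on {a..b} g0"
    using ab by (intro DERIV_continuous_on[where D=g1] has_field_derivative_at_within[OF g0]) auto
  show "continuous_on {a..b} g1" using abs_cont_continuous[OF g1[OF ab]] .
qed

lemma error_measurable: "(\<lambda>x. g2 x - s2 x) \<in> borel_measurable (lebesgue_on {a..b})"
proof -
  have "g2 \<in> borel_measurable (lebesgue_on {a..b})"
    by (rule measurable_restrict_mono[OF g2_measurable]) (use ab in auto)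
  then show ?thesis
    using continuous_imp_measurable_on_sets_lebesgue[OF s2_cont] by auto
qed

text \<open>Both squares are dominated through \<open>x * (g2 x)\<^sup>2 \<le> E x\<close> and the
  continuity of \<open>s2\<close>; since the weight is at least \<open>a > 0\<close>, the unweighted
  square follows.\<close>

lemma error_integrable:
  "(\<lambda>x. x * (g2 x - s2 x)\<^sup>2) integrable_on {a..b}" "(\<lambda>x. (g2 x - s2 x)\<^sup>2) integrable_on {a..b}"
proof -
  have dom: "(\<lambda>x. 2 * E x + 2 * (x * (s2 x)\<^sup>2)) integrable_on {a..b}"
    by (intro integrable_add integrable_on_mult_right energy_integrable ab
        integrable_continuous_interval[of _ _ "\<lambda>x. x * (s2 x)\<^sup>2"] continuous_intros s2_cont)
  have le: "x * (g2 x - s2 x)\<^sup>2 \<le> 2 * E x + 2 * (x * (s2 x)\<^sup>2)" if "x \<in> {a..b}" for x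
  proof -
    have x: "x \<ge> 0" using that ab by auto
    have "(g2 x - s2 x)\<^sup>2 \<le> 2 * (g2 x)\<^sup>2 + 2 * (s2 x)\<^sup>2"
      using zero_le_power2[of "g2 x + s2 x"] by (simp add: power2_eq_square algebra_simps)
    then have "x * (g2 x - s2 x)\<^sup>2 \<le> x * (2 * (g2 x)\<^sup>2 + 2 * (s2 x)\<^sup>2)" using x by (rule mult_left_mono)
    also have "\<dots> = 2 * (x * (g2 x)\<^sup>2) + 2 * (x * (s2 x)\<^sup>2)" by (simp add: algebra_simps)
    finally show ?thesis using energy_density_ge[OF x, of "g2 x" k "g0 x" "g1 x"] by linarith
  qed
  have meas: "(\<lambda>x. (g2 x - s2 x)\<^sup>2) \<in> borel_measurable (lebesgue_on {a..b})"
    using error_measurable by (rule borel_measurable_power)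
  have "(\<lambda>x::real. x) \<in> borel_measurable (lebesgue_on {a..b})"
    by (intro continuous_imp_measurable_on_sets_lebesgue continuous_intros) auto
  from borel_measurable_times[OF this meas]
  have measx: "(\<lambda>x. x * (g2 x - s2 x)\<^sup>2) \<in> borel_measurable (lebesgue_on {a..b})" .
  show "(\<lambda>x. x * (g2 x - s2 x)\<^sup>2) integrable_on {a..b}"
    by (rule measurable_bounded_by_integrable_imp_integrable[OF measx dom])
      (use le ab in auto)
  show "(\<lambda>x. (g2 x - s2 x)\<^sup>2) integrable_on {a..b}"
  proof (rule measurable_bounded_by_integrable_imp_integrable[OF meas integrable_on_mult_right[OF dom, of "1 / a"]])
    fix x assume x: "x \<in> {a..b}"
    have "a * (g2 x - s2 x)\<^sup>2 \<le> x * (g2 x - s2 x)\<^sup>2" using x by (intro mult_right_mono) auto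
    with le[OF x] have "a * (g2 x - s2 x)\<^sup>2 \<le> 2 * E x + 2 * (x * (s2 x)\<^sup>2)" by linarith
    then show "norm ((g2 x - s2 x)\<^sup>2) \<le> 1 / a * (2 * E x + 2 * (x * (s2 x)\<^sup>2))"
      using ab by (simp add: field_simps)
  qed auto
qed

text \<open>Integration by parts on \<open>[c, d]\<close> inside the piece; since \<open>M\<close> is bounded and the error vanishes at
  both knots, the third-order boundary terms disappear in the limit.\<close>
lemma energy_ge_error_plus_boundary:
  "integral {a..b} (\<lambda>x. x * (g2 x - s2 x)\<^sup>2)
     + 2 * (b * (g1 b - s1 b) * s2 b - a * (g1 a - s1 a) * s2 a) \<le> integral {a..b} E"
proof -
  define e0 where "e0 x = g0 x - s0 x" for x
  define e1 where "e1 x = g1 x - s1 x" for x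
  define W where "W x = x * e1 x * s2 x + e0 x * M x" for x
  define D where "D x = E x - x * (g2 x - s2 x)\<^sup>2" for x
  \<comment> \<open>The claim is \<open>F a \<le> F b\<close>. Between the knots \<open>F\<close> is
    nondecreasing by integration by parts, and it is continuous up to them because
    \<open>e0 * M\<close> is.\<close>
  define F where "F x = integral {a..x} D - 2 * W x" for x
  have e_end: "e0 a = 0" "e0 b = 0" using interp unfolding e0_def by auto
  have D: "D integrable_on {a..b}"
    unfolding D_def using energy_integrable[OF ab(1)] error_integrable(1) by (rule integrable_diff)
  obtain B where B: "\<And>x. x \<in> {a<..<b} \<Longrightarrow> \<bar>M x\<bar> \<le> B" by (rule M_bounded) blast
  have Mcont: "continuous_on {a<..<b} M"
    using DERIV_isCont[OF M_derivative] by (auto intro: continuous_at_imp_continuous_on)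
  have F_cont: "continuous_on {a..b} F"
    unfolding F_def W_def e1_def
    by (intro continuous_intros continuous_on_mult_bounded[OF _ e_end Mcont B]
        indefinite_integral_continuous_1 D s2_cont g_cont s_cont)
      (auto simp: e0_def intro!: continuous_intros g_cont s_cont)
  have F_mono: "F c \<le> F d" if cd: "a < c" "c < d" "d < b" for c d
  proof -
    have sub: "{c..d} \<subseteq> {a..b}" "{c..d} \<subseteq> {a<..<b}" "0 < c" using cd ab by auto
    have acs0: "abs_cont s0 c d"
      by (rule abs_cont_C1[of _ _ _ s1]) (use sub s0 s_cont continuous_on_subset in blast)+
    have acs1: "abs_cont s1 c d"
      by (rule abs_cont_C1[of _ _ _ s2]) (use sub s1 s2_cont continuous_on_subset in blast)+
    have acs2: "abs_cont s2 c d"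
    proof (rule abs_cont_C1[of _ _ _ s3])
      show "continuous_on {c..d} s3"
        using DERIV_isCont[OF s3] sub by (auto intro!: continuous_at_imp_continuous_on)
    qed (use sub s2 in blast)
    have acM: "abs_cont M c d"
    proof (rule abs_cont_C1[of _ _ _ M'])
      show "continuous_on {c..d} M'"
        unfolding M'_def using sub by (intro continuous_intros continuous_on_subset[OF s_cont(1)] continuous_on_subset[OF s_cont(2)]) auto
    qed (use sub M_derivative in blast)
    have acg0: "abs_cont g0 c d"
      by (rule abs_cont_C1[of _ _ _ g1]) (use sub g0 g_cont continuous_on_subset in force)+
    have acx: "abs_cont (\<lambda>x. x) c d" by (rule abs_cont_C1[of _ _ _ "\<lambda>_. 1"]) auto
    have "abs_cont W c d"
      unfolding W_def e0_def e1_def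
      by (intro abs_cont_add abs_cont_mult abs_cont_diff acx acg0 acs0 acs1 acs2 acM g1 sub cd)
    then have W: "((\<lambda>x. energy_bilinear k x (e0 x) (e1 x) (g2 x - s2 x) (s0 x) (s1 x) (s2 x)) has_integral W d - W c) {c..d}"
    proof (rule abs_cont_has_integral[OF _ _ N])
      fix x assume x: "x \<in> {c<..<d} - N"
      then have x': "x \<in> {a<..<b}" "x \<in> {a..b}" "x > 0" using sub by auto
      \<comment> \<open>The third derivative occurs only in
        \<open>e1 x * (s2 x + x * s3 x + M x)\<close>, where it cancels.\<close>
      have "(W has_real_derivative (e1 x * s2 x + x * (g2 x - s2 x) * s2 x + x * e1 x * s3 x) + (e1 x * M x + e0 x * M' x)) (at x)"
        unfolding W_def e0_def e1_def using x x'
        by (auto intro!: derivative_eq_intros g0 g2 s0 s1 s2 M_derivative simp: algebra_simps)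
      moreover have "(e1 x * s2 x + x * (g2 x - s2 x) * s2 x + x * e1 x * s3 x) + (e1 x * M x + e0 x * M' x)
          = energy_bilinear k x (e0 x) (e1 x) (g2 x - s2 x) (s0 x) (s1 x) (s2 x)"
        unfolding M_def M'_def energy_bilinear_def using x'
        by (simp add: field_simps power2_eq_square power3_eq_cube power4_eq_xxxx)
      ultimately show "(W has_real_derivative energy_bilinear k x (e0 x) (e1 x) (g2 x - s2 x) (s0 x) (s1 x) (s2 x)) (at x)"
        by simp
    qed (use cd in auto)
    have Dcd: "D integrable_on {c..d}" using D sub(1) by (rule integrable_on_subinterval)
    have "2 * (W d - W c) \<le> integral {c..d} D"
    proof (rule has_integral_le[OF has_integral_mult_right[OF W] integrable_integral[OF Dcd]])
      fix x assume "x \<in> {c..d}"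
      then have "x \<ge> 0" using sub by auto
      from energy_density_split[OF this, of "g2 x" "s2 x" k "g0 x" "s0 x" "g1 x" "s1 x"]
      show "2 * energy_bilinear k x (e0 x) (e1 x) (g2 x - s2 x) (s0 x) (s1 x) (s2 x) \<le> D x"
        unfolding D_def e0_def e1_def by linarith
    qed
    moreover have "integral {a..c} D + integral {c..d} D = integral {a..d} D"
      using cd integrable_on_subinterval[OF D, of a d]
      by (intro Henstock_Kurzweil_Integration.integral_combine) auto
    then have "F d - F c = integral {c..d} D - 2 * (W d - W c)" unfolding F_def by simp
    ultimately show ?thesis by linarith
  qed
  have "F a \<le> F b"
  proof -
    have "F a \<le> F d" if d: "a < d" "d < b" for d
    proof (rule tendsto_upperbound)
      show "(F \<longlongrightarrow> F a) (at a within {a..b})" using F_cont ab unfolding continuous_on_def by simp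
      show "\<forall>\<^sub>F c in at a within {a..b}. F c \<le> F d"
        unfolding eventually_at using d by (intro exI[of _ "d - a"]) (auto simp: dist_real_def intro!: F_mono)
      show "at a within {a..b} \<noteq> bot" using ab by (simp add: at_within_Icc_at_right)
    qed
    note Fa = this
    show ?thesis
    proof (rule tendsto_lowerbound)
      show "(F \<longlongrightarrow> F b) (at b within {a..b})" using F_cont ab unfolding continuous_on_def by simp
      show "\<forall>\<^sub>F c in at b within {a..b}. F a \<le> F c"
        unfolding eventually_at using ab by (intro exI[of _ "b - a"]) (auto simp: dist_real_def intro!: Fa)
      show "at b within {a..b} \<noteq> bot" using ab by (simp add: at_within_Icc_at_left)
    qed
  qed
  moreover have "integral {a..b} D = integral {a..b} E - integral {a..b} (\<lambda>x. x * (g2 x - s2 x)\<^sup>2)"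
    unfolding D_def using energy_integrable[OF ab(1)] error_integrable(1) by (rule Henstock_Kurzweil_Integration.integral_diff)
  ultimately show ?thesis unfolding F_def W_def e_end by (simp add: e1_def)
qed

end

section \<open>Error bounds for real splines\<close>

text \<open>The form is quadratic in \<open>u1\<close>, and the end condition says that its
  derivative in \<open>u1\<close> at \<open>v1\<close> is \<open>2 * x * v2\<close>. Expanding
  around \<open>v1\<close> gives the cross term that integration by parts leaves at the outer
  knots.\<close>

lemma boundary_form_split:
  assumes "x > 0" "v2 - (2 * c + 1) / x * v1 + c * (c + 2) / x\<^sup>2 * u0 = 0"
  shows "boundary_form c x u0 u1
    = boundary_form c x 0 (u1 - v1) + 2 * (x * (u1 - v1) * v2) + boundary_form c x u0 v1"
proof -
  have v2: "x * v2 = (2 * c + 1) * v1 - c * (c + 2) * u0 / x"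
  proof -
    have "v2 = (2 * c + 1) / x * v1 - c * (c + 2) / x\<^sup>2 * u0" using assms(2) by linarith
    moreover have "x * ((2 * c + 1) / x * v1 - c * (c + 2) / x\<^sup>2 * u0) = (2 * c + 1) * v1 - c * (c + 2) * u0 / x"
      using assms(1) by (simp add: field_simps power2_eq_square)
    ultimately show ?thesis by simp
  qed
  have e: "x * (u1 - v1) * v2 = (u1 - v1) * ((2 * c + 1) * v1 - c * (c + 2) * u0 / x)"
    unfolding v2[symmetric] by simp
  show ?thesis
    unfolding boundary_form_def e by (simp add: power2_eq_square algebra_simps diff_divide_distrib add_divide_distrib)
qed

section \<open>Splitting at the knots and estimates on one interval\<close>

lemma integral_partition:
  fixes f :: "real \<Rightarrow> real" and r :: "nat \<Rightarrow> real"
  assumes "m \<le> n" "f integrable_on {r m..r n}" "\<And>j. m \<le> j \<Longrightarrow> j < n \<Longrightarrow> r j \<le> r (Suc j)"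
  shows "integral {r m..r n} f = (\<Sum>j=m..<n. integral {r j..r (Suc j)} f)"
  using assms
proof (induction n rule: nat_induct_at_least)
  case base
  then show ?case by simp
next
  case (Suc n)
  have mn: "r m \<le> r n" using Suc.hyps Suc.prems(2)
    by (induction n rule: nat_induct_at_least) (auto intro: order_trans)
  have nn: "r n \<le> r (Suc n)" using Suc by auto
  have "f integrable_on {r m..r n}"
    by (rule integrable_on_subinterval[OF Suc.prems(1)]) (use nn in auto)
  then have "integral {r m..r n} f = (\<Sum>j=m..<n. integral {r j..r (Suc j)} f)"
    using Suc by auto
  moreover have "integral {r m..r n} f + integral {r n..r (Suc n)} f = integral {r m..r (Suc n)} f"
    using mn nn Suc.prems(1) by (intro Henstock_Kurzweil_Integration.integral_combine) auto
  ultimately show ?case using Suc.hyps by simp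
qed

lemma square_integral_le:
  fixes f :: "real \<Rightarrow> real"
  assumes "(f has_integral I) {a..b}" "(\<lambda>x. (f x)\<^sup>2) integrable_on {a..b}" "a \<le> b"
  shows "I\<^sup>2 \<le> (b - a) * integral {a..b} (\<lambda>x. (f x)\<^sup>2)"
proof (cases "a = b")
  case True
  then have "I = 0" using assms(1) has_integral_refl(2)[of f a] has_integral_unique by auto
  then show ?thesis using True by simp
next
  case False
  then have ab: "b - a > 0" using assms(3) by simp
  \<comment> \<open>The mean value of \<open>f\<close>; nonnegativity of the integral of the square
    of \<open>f - m\<close> is Cauchy-Schwarz against the constant 1.\<close>
  define m where "m = I / (b - a)"
  have "((\<lambda>x. (f x)\<^sup>2 - 2 * m * f x + m\<^sup>2) has_integral
      integral {a..b} (\<lambda>x. (f x)\<^sup>2) - 2 * m * I + (b - a) * m\<^sup>2) {a..b}"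
    using has_integral_const_real[of "m\<^sup>2" a b] assms(3)
    by (intro has_integral_add has_integral_diff integrable_integral assms(2) has_integral_mult_right assms(1)) simp
  then have "0 \<le> integral {a..b} (\<lambda>x. (f x)\<^sup>2) - 2 * m * I + (b - a) * m\<^sup>2"
  proof (rule has_integral_nonneg)
    fix x
    have "(f x)\<^sup>2 - 2 * m * f x + m\<^sup>2 = (f x - m)\<^sup>2" by (simp add: power2_eq_square algebra_simps)
    then show "0 \<le> (f x)\<^sup>2 - 2 * m * f x + m\<^sup>2" by simp
  qed
  also have "\<dots> = integral {a..b} (\<lambda>x. (f x)\<^sup>2) - I\<^sup>2 / (b - a)"
  proof -
    have "2 * m * I = 2 * (I\<^sup>2 / (b - a))" "(b - a) * m\<^sup>2 = I\<^sup>2 / (b - a)"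
      unfolding m_def using ab by (simp_all add: power2_eq_square)
    then show ?thesis by linarith
  qed
  finally show ?thesis using ab by (simp add: field_simps)
qed

text \<open>The factor 1/2 comes from estimating \<open>e0 x\<close> from both end points and
  adding: the two distances sum to \<open>b - a\<close>.\<close>

lemma two_point_interpolation_error:
  fixes e0 e1 e2 :: "real \<Rightarrow> real"
  assumes "a < b" "e0 a = 0" "e0 b = 0"
    and e0: "\<And>x. x \<in> {a..b} \<Longrightarrow> (e0 has_real_derivative e1 x) (at x)"
    and e1: "abs_cont e1 a b" "negligible N" "\<And>x. x \<in> {a<..<b} - N \<Longrightarrow> (e1 has_real_derivative e2 x) (at x)"
    and sq: "(\<lambda>x. (e2 x)\<^sup>2) integrable_on {a..b}"
    and J: "integral {a..b} (\<lambda>x. (e2 x)\<^sup>2) \<le> J" and h: "b - a \<le> h"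
    and x: "x \<in> {a..b}"
  shows "\<bar>e1 x\<bar> \<le> sqrt (h * J)" "\<bar>e0 x\<bar> \<le> h / 2 * sqrt (h * J)"
proof -
  have J0: "0 \<le> integral {a..b} (\<lambda>x. (e2 x)\<^sup>2)" by (rule integral_nonneg[OF sq]) auto
  obtain z where z: "a < z" "z < b" "e1 z = 0"
  proof -
    have "\<exists>z>a. z < b \<and> e0 b - e0 a = (b - a) * e1 z"
      using assms(1) e0 by (intro MVT2) auto
    then show thesis using that assms by auto
  qed
  have incr: "(e1 y - e1 w)\<^sup>2 \<le> h * J" if wy: "a \<le> w" "w < y" "y \<le> b" for w y
  proof -
    have sqwy: "(\<lambda>x. (e2 x)\<^sup>2) integrable_on {w..y}"
      using wy by (intro integrable_on_subinterval[OF sq]) auto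
    have "(e2 has_integral e1 y - e1 w) {w..y}"
      using wy by (intro abs_cont_has_integral[OF abs_cont_subset[OF e1(1)] _ e1(2)] e1(3)) auto
    from square_integral_le[OF this sqwy]
    have "(e1 y - e1 w)\<^sup>2 \<le> (y - w) * integral {w..y} (\<lambda>x. (e2 x)\<^sup>2)" using wy by simp
    also have "integral {w..y} (\<lambda>x. (e2 x)\<^sup>2) \<le> integral {a..b} (\<lambda>x. (e2 x)\<^sup>2)"
      using wy by (intro integral_subset_le sq sqwy) auto
    also have "(y - w) * integral {a..b} (\<lambda>x. (e2 x)\<^sup>2) \<le> h * J"
      using wy J h J0 by (intro mult_mono) auto
    finally show ?thesis using wy by (simp add: mult_left_mono)
  qed
  have e1_bound: "\<bar>e1 y\<bar> \<le> sqrt (h * J)" if y: "y \<in> {a..b}" for y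
  proof -
    have "(e1 y)\<^sup>2 \<le> h * J"
    proof (cases "y = z")
      case True
      then show ?thesis using z J h J0 assms(1) by simp
    next
      case False
      then show ?thesis using incr[of z y] incr[of y z] z y by (cases "z < y") auto
    qed
    then show ?thesis using real_le_rsqrt[of "\<bar>e1 y\<bar>" "h * J"] by simp
  qed
  show "\<bar>e1 x\<bar> \<le> sqrt (h * J)" by (rule e1_bound[OF x])
  have lip: "\<bar>e0 y - e0 w\<bar> \<le> sqrt (h * J) * (y - w)" if wy: "a \<le> w" "w \<le> y" "y \<le> b" for w y
  proof -
    have "norm (e0 y - e0 w) \<le> sqrt (h * J) * norm (y - w)"
    proof (rule field_differentiable_bound[of "{a..b}" e0 e1])
      fix t assume t: "t \<in> {a..b}"
      show "(e0 has_field_derivative e1 t) (at t within {a..b})"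
        using e0[OF t] by (rule has_field_derivative_at_within)
      show "norm (e1 t) \<le> sqrt (h * J)" using e1_bound[OF t] by simp
    qed (use wy in auto)
    then show ?thesis using wy by simp
  qed
  have "2 * \<bar>e0 x\<bar> \<le> sqrt (h * J) * (x - a) + sqrt (h * J) * (b - x)"
    using lip[of a x] lip[of x b] assms(2,3) x by auto
  also have "\<dots> = sqrt (h * J) * (b - a)" by (simp add: algebra_simps)
  also have "\<dots> \<le> sqrt (h * J) * h" using h J J0 assms(1) by (intro mult_left_mono) auto
  finally show "\<bar>e0 x\<bar> \<le> h / 2 * sqrt (h * J)" by (simp add: mult.commute)
qed

lemma knot_interval_cover:
  fixes r :: "nat \<Rightarrow> real"
  assumes "2 \<le> n" "x \<in> {r 1..r n}"
  obtains j where "j \<in> {1..<n}" "x \<in> {r j..r (Suc j)}"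
proof -
  \<comment> \<open>The last index below \<open>n\<close> whose knot is not beyond \<open>x\<close>;
    excluding \<open>n\<close> puts \<open>r n\<close> into the last interval.\<close>
  define j where "j = Max {j \<in> {1..<n}. r j \<le> x}"
  have ne: "1 \<in> {j \<in> {1..<n}. r j \<le> x}" using assms by auto
  have "j \<in> {j \<in> {1..<n}. r j \<le> x}" unfolding j_def by (rule Max_in) (use ne in auto)
  moreover have "x \<le> r (Suc j)"
  proof (rule ccontr)
    assume x: "\<not> x \<le> r (Suc j)"
    then have "Suc j \<noteq> n" using assms by auto
    then have "Suc j \<in> {j \<in> {1..<n}. r j \<le> x}" using calculation x by auto
    then have "Suc j \<le> j" unfolding j_def by (intro Max_ge) auto
    then show False by simp
  qed
  ultimately show thesis using that by auto
qed

text \<open>The functions \<open>s0\<close> to \<open>s4\<close> are a real component of the spline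
  and its derivatives. The outer pieces are represented by \<open>left\<close> and
  \<open>right\<close>, the equations for G_k and R_k in the limit at the outer knots.\<close>

locale spline_interpolation = finite_energy g0 g1 g2 N k
  for g0 g1 g2 :: "real \<Rightarrow> real" and N k +
  fixes n :: nat and r :: "nat \<Rightarrow> real" and s0 s1 s2 s3 s4 :: "real \<Rightarrow> real"
  assumes n: "2 \<le> n" and r1: "0 < r 1" and r_mono: "strict_mono_on {1..n} r"
    and s0: "\<And>x. x \<in> {r 1..r n} \<Longrightarrow> (s0 has_real_derivative s1 x) (at x)"
    and s1: "\<And>x. x \<in> {r 1..r n} \<Longrightarrow> (s1 has_real_derivative s2 x) (at x)"
    and s2_cont: "continuous_on {r 1..r n} s2"
    and s2: "\<And>j x. j \<in> {1..<n} \<Longrightarrow> x \<in> {r j<..<r (Suc j)} \<Longrightarrow> (s2 has_real_derivative s3 x) (at x)"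
    and s3: "\<And>j x. j \<in> {1..<n} \<Longrightarrow> x \<in> {r j<..<r (Suc j)} \<Longrightarrow> (s3 has_real_derivative s4 x) (at x)"
    and ode: "\<And>j x. j \<in> {1..<n} \<Longrightarrow> x \<in> {r j<..<r (Suc j)} \<Longrightarrow>
      x * s4 x + 2 * s3 x - (2 * k\<^sup>2 + 1) / x * s2 x
      + (2 * k\<^sup>2 + 1) / x\<^sup>2 * s1 x + (k ^ 4 - 4 * k\<^sup>2) / x ^ 3 * s0 x = 0"
    and left: "s2 (r 1) - (2 * k + 1) / r 1 * s1 (r 1) + k * (k + 2) / (r 1)\<^sup>2 * s0 (r 1) = 0"
    and right: "s2 (r n) + (2 * k - 1) / r n * s1 (r n) + k * (k - 2) / (r n)\<^sup>2 * s0 (r n) = 0"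
    and interp: "\<And>j. j \<in> {1..n} \<Longrightarrow> s0 (r j) = g0 (r j)"
begin

lemma knots:
  assumes "j \<in> {1..<n}"
  shows "0 < r j" "r j < r (Suc j)" "r 1 \<le> r j" "r (Suc j) \<le> r n"
proof -
  show "r j < r (Suc j)" using assms by (intro strict_mono_onD[OF r_mono]) auto
  show *: "r 1 \<le> r j" "r (Suc j) \<le> r n"
    using assms by (auto intro!: monotone_onD[OF strict_mono_on_imp_mono_on[OF r_mono]])
  show "0 < r j" using * r1 by linarith
qed

lemma piece:
  assumes j: "j \<in> {1..<n}"
  shows "interpolated_piece g0 g1 g2 N k s0 s1 s2 s3 s4 (r j) (r (Suc j))"
proof
  have sub: "{r j..r (Suc j)} \<subseteq> {r 1..r n}" using knots[OF j] by auto
  show "0 < r j" "r j < r (Suc j)" using knots[OF j] by auto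
  show "continuous_on {r j..r (Suc j)} s2" by (rule continuous_on_subset[OF s2_cont sub])
  show "s0 (r j) = g0 (r j)" "s0 (r (Suc j)) = g0 (r (Suc j))" using interp j by auto
qed (use knots[OF j] s0 s1 s2[OF j] s3[OF j] ode[OF j] in auto)

abbreviation "T \<equiv> integral {0<..} E"

text \<open>The terms \<open>P\<close> telescope because \<sigma>', \<sigma>'' and g' are continuous
  across the inner knots. What remains, \<open>2 * (P n - P 1)\<close>, is absorbed by the lower
  bounds for the energy on the two outer intervals.\<close>

lemma error_energy_le: "(\<Sum>j=1..<n. integral {r j..r (Suc j)} (\<lambda>x. x * (g2 x - s2 x)\<^sup>2)) \<le> T"
proof -
  have k1: "k \<ge> 1" using k by auto
  have r1n: "r 1 < r n" using n by (intro strict_mono_onD[OF r_mono]) auto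
  define P where "P j = r j * (g1 (r j) - s1 (r j)) * s2 (r j)" for j
  have pieces: "integral {r j..r (Suc j)} (\<lambda>x. x * (g2 x - s2 x)\<^sup>2) + 2 * (P (Suc j) - P j)
      \<le> integral {r j..r (Suc j)} E" if "j \<in> {1..<n}" for j
    using interpolated_piece.energy_ge_error_plus_boundary[OF piece[OF that]] unfolding P_def .
  have middle: "(\<Sum>j=1..<n. integral {r j..r (Suc j)} (\<lambda>x. x * (g2 x - s2 x)\<^sup>2)) + 2 * (P n - P 1)
      \<le> integral {r 1..r n} E"
  proof -
    have "(\<Sum>j=1..<n. integral {r j..r (Suc j)} (\<lambda>x. x * (g2 x - s2 x)\<^sup>2) + 2 * (P (Suc j) - P j))
        \<le> (\<Sum>j=1..<n. integral {r j..r (Suc j)} E)"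
      by (intro sum_mono pieces)
    moreover have "(\<Sum>j=1..<n. 2 * (P (Suc j) - P j)) = 2 * (P n - P 1)"
      unfolding sum_distrib_left[symmetric] using sum_Suc_diff'[of 1 n P] n by simp
    moreover have "integral {r 1..r n} E = (\<Sum>j=1..<n. integral {r j..r (Suc j)} E)"
      using n energy_integrable[OF r1] knots(2) by (intro integral_partition) (auto intro: less_imp_le)
    ultimately show ?thesis by (simp add: sum.distrib)
  qed
  \<comment> \<open>Expanding around the spline, the forms of the error and of the spline are both
    nonnegative, leaving the cross term; at \<open>r n\<close> both are nonpositive.\<close>
  have left_end: "2 * P 1 \<le> V k (r 1)"
    using boundary_form_split[OF r1 left, of "g1 (r 1)"] interp[of 1] n
      boundary_form_nonneg[OF k1, of "r 1" 0 "g1 (r 1) - s1 (r 1)"]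
      boundary_form_nonneg[OF k1, of "r 1" "s0 (r 1)" "s1 (r 1)"]
    unfolding P_def by auto
  have right_end: "V (- k) (r n) \<le> 2 * P n"
  proof -
    have "s2 (r n) - (2 * - k + 1) / r n * s1 (r n) + - k * (- k + 2) / (r n)\<^sup>2 * s0 (r n) = 0"
      using right by (simp add: algebra_simps add_divide_distrib diff_divide_distrib)
    from boundary_form_split[OF _ this, of "g1 (r n)"] show ?thesis
      using r1 r1n interp[of n] n
        boundary_form_neg_nonpos[OF k, of "r n" 0 "g1 (r n) - s1 (r n)"]
        boundary_form_neg_nonpos[OF k, of "r n" "s0 (r n)" "s1 (r n)"]
      unfolding P_def by auto
  qed
  \<comment> \<open>The outer forms are known to be small only at suitable single points \<epsilon>
    and \<open>R\<close>, hence the slack \<eta>.\<close>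
  have "(\<Sum>j=1..<n. integral {r j..r (Suc j)} (\<lambda>x. x * (g2 x - s2 x)\<^sup>2)) \<le> T + \<eta>" if "\<eta> > 0" for \<eta>
  proof -
    have \<eta>: "\<eta> / 2 > 0" using that by simp
    obtain \<epsilon> where \<epsilon>: "0 < \<epsilon>" "\<epsilon> < r 1" "\<bar>V k \<epsilon>\<bar> < \<eta> / 2"
      using small_near_ends[OF boundary[of k] _ \<eta> r1] by auto
    have rn: "0 < r n" using r1 r1n by linarith
    obtain R where R: "r n < R" "\<bar>V (- k) R\<bar> < \<eta> / 2"
      using small_near_ends[OF boundary[of "- k"] _ \<eta> rn] by auto
    have "V k (r 1) - V k \<epsilon> \<le> integral {\<epsilon>..r 1} E" "V (- k) R - V (- k) (r n) \<le> integral {r n..R} E"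
      using \<epsilon> R rn by (auto intro!: energy_ge_boundary_form_diff)
    moreover have "integral {\<epsilon>..r 1} E + integral {r 1..r n} E = integral {\<epsilon>..r n} E"
      "integral {\<epsilon>..r n} E + integral {r n..R} E = integral {\<epsilon>..R} E"
      using \<epsilon> R r1n energy_integrable[OF \<epsilon>(1)]
      by (auto intro!: Henstock_Kurzweil_Integration.integral_combine)
    moreover have "integral {\<epsilon>..R} E \<le> T"
      using \<epsilon>(1)
      by (intro integral_subset_le energy_integrable energy) (auto intro!: energy_density_nonneg)
    moreover have "- (\<eta> / 2) < V (- k) R" "V k \<epsilon> < \<eta> / 2" using \<epsilon>(3) R(2) by auto
    moreover note middle left_end right_end
    ultimately show ?thesis by (smt (verit) field_sum_of_halves)
  qed
  then show ?thesis by (rule field_le_epsilon)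
qed

lemma error_continuous:
  "continuous_on {r 1..r n} (\<lambda>x. g0 x - s0 x)" "continuous_on {r 1..r n} (\<lambda>x. g1 x - s1 x)"
proof -
  have r1n: "r 1 < r n" using n by (intro strict_mono_onD[OF r_mono]) auto
  have "continuous_on {r 1..r n} g0"
    using r1 by (intro DERIV_continuous_on[where D=g1] has_field_derivative_at_within[OF g0]) auto
  moreover have "continuous_on {r 1..r n} g1" using abs_cont_continuous[OF g1[OF r1 r1n]] .
  moreover have "continuous_on {r 1..r n} s0"
    by (intro DERIV_continuous_on[where D=s1] has_field_derivative_at_within[OF s0]) auto
  moreover have "continuous_on {r 1..r n} s1"
    by (intro DERIV_continuous_on[where D=s2] has_field_derivative_at_within[OF s1]) auto
  ultimately show "continuous_on {r 1..r n} (\<lambda>x. g0 x - s0 x)" "continuous_on {r 1..r n} (\<lambda>x. g1 x - s1 x)"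
    by (auto intro: continuous_intros)
qed

definition "J j = integral {r j..r (Suc j)} (\<lambda>x. (g2 x - s2 x)\<^sup>2)"

lemma J_nonneg: "j \<in> {1..<n} \<Longrightarrow> 0 \<le> J j"
  unfolding J_def using interpolated_piece.error_integrable(2)[OF piece] by (intro integral_nonneg) auto

text \<open>The origin of 1 / sqrt r_1: the weight of the energy is at least \<open>r 1\<close> on
  all pieces.\<close>

lemma J_sum: "r 1 * (\<Sum>j=1..<n. J j) \<le> T"
proof -
  have "r 1 * J j \<le> integral {r j..r (Suc j)} (\<lambda>x. x * (g2 x - s2 x)\<^sup>2)" if j: "j \<in> {1..<n}" for j
  proof -
    note int = interpolated_piece.error_integrable[OF piece[OF j]]
    have "r 1 * J j = integral {r j..r (Suc j)} (\<lambda>x. r 1 * (g2 x - s2 x)\<^sup>2)"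
      unfolding J_def by simp
    also have "\<dots> \<le> integral {r j..r (Suc j)} (\<lambda>x. x * (g2 x - s2 x)\<^sup>2)"
      using knots(3)[OF j] by (intro integral_le integrable_on_mult_right int mult_right_mono) auto
    finally show ?thesis .
  qed
  then have "(\<Sum>j=1..<n. r 1 * J j) \<le> (\<Sum>j=1..<n. integral {r j..r (Suc j)} (\<lambda>x. x * (g2 x - s2 x)\<^sup>2))"
    by (intro sum_mono) auto
  then show ?thesis using error_energy_le by (simp add: sum_distrib_left)
qed

section \<open>Error bounds in terms of the mesh size\<close>

context
  fixes h :: real
  assumes h: "\<And>j. j \<in> {1..<n} \<Longrightarrow> r (Suc j) - r j \<le> h"
begin

lemma h_nonneg: "0 \<le> h"
  using h[of 1] knots(2)[of 1] n by force

lemma piece_bounds: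
  assumes j: "j \<in> {1..<n}" and x: "x \<in> {r j..r (Suc j)}"
  shows "\<bar>g1 x - s1 x\<bar> \<le> sqrt (h * J j)" "\<bar>g0 x - s0 x\<bar> \<le> h / 2 * sqrt (h * J j)"
proof -
  interpret p: interpolated_piece g0 g1 g2 N k s0 s1 s2 s3 s4 "r j" "r (Suc j)" by (rule piece[OF j])
  have d0: "((\<lambda>x. g0 x - s0 x) has_real_derivative g1 x - s1 x) (at x)" if "x \<in> {r j..r (Suc j)}" for x
    using that p.ab p.s0 g0 by (intro derivative_intros) auto
  have ac: "abs_cont (\<lambda>x. g1 x - s1 x) (r j) (r (Suc j))"
    by (intro abs_cont_diff g1 p.ab abs_cont_C1[OF p.s1 p.s2_cont])
  have d1: "((\<lambda>x. g1 x - s1 x) has_real_derivative g2 x - s2 x) (at x)"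
    if "x \<in> {r j<..<r (Suc j)} - N" for x
    using that p.ab p.s1 g2 by (intro derivative_intros) auto
  have ends: "g0 (r j) - s0 (r j) = 0" "g0 (r (Suc j)) - s0 (r (Suc j)) = 0" using p.interp by auto
  note b = two_point_interpolation_error[OF p.ab(2) ends d0 ac N d1 p.error_integrable(2) _ h[OF j] x, of "J j"]
  show "\<bar>g1 x - s1 x\<bar> \<le> sqrt (h * J j)" "\<bar>g0 x - s0 x\<bar> \<le> h / 2 * sqrt (h * J j)"
    by (rule b; simp add: J_def)+
qed

lemma uniform_bounds:
  assumes x: "x \<in> {r 1..r n}"
  shows "\<bar>g1 x - s1 x\<bar> \<le> sqrt (h * (T / r 1))" "\<bar>g0 x - s0 x\<bar> \<le> h / 2 * sqrt (h * (T / r 1))"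
proof -
  obtain j where j: "j \<in> {1..<n}" "x \<in> {r j..r (Suc j)}" using knot_interval_cover[OF n x] by blast
  have "J j \<le> (\<Sum>j=1..<n. J j)" using j J_nonneg by (intro member_le_sum) auto
  also have "\<dots> \<le> T / r 1" using J_sum r1 by (simp add: field_simps)
  finally have "sqrt (h * J j) \<le> sqrt (h * (T / r 1))"
    using h_nonneg by (intro real_sqrt_le_mono mult_left_mono)
  moreover from this have "h / 2 * sqrt (h * J j) \<le> h / 2 * sqrt (h * (T / r 1))"
    using h_nonneg by (intro mult_left_mono) auto
  ultimately show "\<bar>g1 x - s1 x\<bar> \<le> sqrt (h * (T / r 1))" "\<bar>g0 x - s0 x\<bar> \<le> h / 2 * sqrt (h * (T / r 1))"
    using piece_bounds[OF j] by linarith+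
qed

text \<open>The pointwise bound keeps the individual \<open>J j\<close>, and each interval
  contributes its length, at most \<open>h\<close>. Summation restores the total energy; the uniform
  bound would instead cost the length of [r_1, r_n].\<close>

lemma square_integral_bound:
  assumes f: "continuous_on {r 1..r n} f" and c: "0 \<le> c"
    and b: "\<And>j x. j \<in> {1..<n} \<Longrightarrow> x \<in> {r j..r (Suc j)} \<Longrightarrow> \<bar>f x\<bar> \<le> c * sqrt (h * J j)"
  shows "integral {r 1..r n} (\<lambda>x. (f x)\<^sup>2) \<le> c\<^sup>2 * h\<^sup>2 * (T / r 1)"
proof -
  have int: "(\<lambda>x. (f x)\<^sup>2) integrable_on {r 1..r n}"
    using f by (intro integrable_continuous_interval continuous_intros)
  have "integral {r 1..r n} (\<lambda>x. (f x)\<^sup>2) = (\<Sum>j=1..<n. integral {r j..r (Suc j)} (\<lambda>x. (f x)\<^sup>2))"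
    using n int knots(2) by (intro integral_partition) (auto intro: less_imp_le)
  also have "\<dots> \<le> (\<Sum>j=1..<n. c\<^sup>2 * h\<^sup>2 * J j)"
  proof (rule sum_mono)
    fix j assume j: "j \<in> {1..<n}"
    have J: "0 \<le> h * J j" using h_nonneg J_nonneg[OF j] by simp
    have le: "(f x)\<^sup>2 \<le> c\<^sup>2 * (h * J j)" if "x \<in> {r j..r (Suc j)}" for x
    proof -
      have "\<bar>f x\<bar>\<^sup>2 \<le> (c * sqrt (h * J j))\<^sup>2" using b[OF j that] by (intro power_mono) auto
      then show ?thesis using J by (simp add: power_mult_distrib)
    qed
    have "integral {r j..r (Suc j)} (\<lambda>x. (f x)\<^sup>2) \<le> integral {r j..r (Suc j)} (\<lambda>x. c\<^sup>2 * (h * J j))"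
      using knots[OF j] le by (intro integral_le integrable_on_subinterval[OF int]) auto
    also have "\<dots> = (r (Suc j) - r j) * (c\<^sup>2 * (h * J j))" using knots(2)[OF j] by simp
    also have "\<dots> \<le> h * (c\<^sup>2 * (h * J j))" using h[OF j] J by (intro mult_right_mono) auto
    finally show "integral {r j..r (Suc j)} (\<lambda>x. (f x)\<^sup>2) \<le> c\<^sup>2 * h\<^sup>2 * J j"
      by (simp add: power2_eq_square algebra_simps)
  qed
  also have "\<dots> = c\<^sup>2 * h\<^sup>2 * (\<Sum>j=1..<n. J j)" by (simp add: sum_distrib_left)
  also have "\<dots> \<le> c\<^sup>2 * h\<^sup>2 * (T / r 1)"
    using J_sum r1 by (intro mult_left_mono) (auto simp: field_simps)
  finally show ?thesis .
qed

lemma mean_square_bounds: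
  "integral {r 1..r n} (\<lambda>x. (g1 x - s1 x)\<^sup>2) \<le> h\<^sup>2 * (T / r 1)"
  "integral {r 1..r n} (\<lambda>x. (g0 x - s0 x)\<^sup>2) \<le> (h / 2)\<^sup>2 * h\<^sup>2 * (T / r 1)"
  using square_integral_bound[OF error_continuous(2), of 1] square_integral_bound[OF error_continuous(1), of "h / 2"]
    piece_bounds h_nonneg by auto

end

end

section \<open>Data functions and Beppo Levi splines\<close>

definition square_integrable :: "real set \<Rightarrow> (real \<Rightarrow> real) \<Rightarrow> bool" where
  "square_integrable S f \<longleftrightarrow> f \<in> borel_measurable (lebesgue_on S) \<and> integrable (lebesgue_on S) (\<lambda>x. (f x)\<^sup>2)"

lemma square_integrable_prod:
  assumes "square_integrable S f" "square_integrable S g"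
  shows "integrable (lebesgue_on S) (\<lambda>x. f x * g x)"
proof (rule Bochner_Integration.integrable_bound)
  show "integrable (lebesgue_on S) (\<lambda>x. (f x)\<^sup>2 + (g x)\<^sup>2)"
    using assms unfolding square_integrable_def by auto
  show "(\<lambda>x. f x * g x) \<in> borel_measurable (lebesgue_on S)"
    using assms unfolding square_integrable_def by auto
  have "norm (f x * g x) \<le> norm ((f x)\<^sup>2 + (g x)\<^sup>2)" for x
    using sum_squares_bound[of "\<bar>f x\<bar>" "\<bar>g x\<bar>"] zero_le_power2[of "f x"] zero_le_power2[of "g x"]
    by (simp add: abs_mult mult.assoc) (smt (verit) mult_nonneg_nonneg abs_ge_zero)
  then show "AE x in lebesgue_on S. norm (f x * g x) \<le> norm ((f x)\<^sup>2 + (g x)\<^sup>2)" by simp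
qed

lemma L2_on_Re:
  assumes "F \<in> L2_on S" "S \<in> sets lebesgue" "\<And>x. x \<in> S \<Longrightarrow> f x = Re (F x)"
  shows "square_integrable S f"
proof -
  have F: "F \<in> borel_measurable (lebesgue_on S)" "integrable (lebesgue_on S) (\<lambda>x. (norm (F x))\<^sup>2)"
    using assms(1) unfolding L2_on_def by auto
  have "(\<lambda>x. Re (F x)) \<in> borel_measurable (lebesgue_on S)" using F(1) by measurable
  then have meas: "f \<in> borel_measurable (lebesgue_on S)"
    by (rule measurable_cong[THEN iffD2, rotated]) (use assms in auto)
  moreover have "integrable (lebesgue_on S) (\<lambda>x. (f x)\<^sup>2)"
  proof (rule Bochner_Integration.integrable_bound[OF F(2)])
    show "(\<lambda>x. (f x)\<^sup>2) \<in> borel_measurable (lebesgue_on S)" using meas by measurable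
    show "AE x in lebesgue_on S. norm ((f x)\<^sup>2) \<le> norm ((norm (F x))\<^sup>2)"
    proof (rule AE_I2)
      fix x assume "x \<in> space (lebesgue_on S)"
      then have "f x = Re (F x)" using assms by auto
      then show "norm ((f x)\<^sup>2) \<le> norm ((norm (F x))\<^sup>2)"
        using abs_Re_le_cmod[of "F x"] power_mono[of "\<bar>Re (F x)\<bar>" "norm (F x)" 2] by simp
    qed
  qed
  ultimately show ?thesis unfolding square_integrable_def by simp
qed

lemma powr_half_squares:
  fixes x :: real
  assumes "x > 0"
  shows "(x powr (1/2))\<^sup>2 = x" "(x powr (-1/2))\<^sup>2 = 1 / x" "x powr (-3/2) = x powr (-1/2) / x"
proof -
  show "(x powr (1/2))\<^sup>2 = x" "(x powr (-1/2))\<^sup>2 = 1 / x"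
    using assms by (simp_all add: powr_power powr_minus_divide power_divide)
  have "x powr (-3/2) = x powr (-1/2 - 1)" by simp
  also have "\<dots> = x powr (-1/2) / x" using assms by (subst powr_diff) simp
  finally show "x powr (-3/2) = x powr (-1/2) / x" .
qed

text \<open>Where g' is not differentiable the iterated \<open>vderiv\<close> is an unspecified
  complex number. Such points lie in the null set \<open>N\<close>, so passing to its real part
  \<open>g2\<close> preserves the energy.\<close>

lemma Lambda_finite_energy:
  fixes g :: "real \<Rightarrow> real" and k :: int
  defines "G \<equiv> \<lambda>x. complex_of_real (g x)"
  assumes k: "k \<noteq> 0" and L1: "\<bar>k\<bar> = 1 \<Longrightarrow> G \<in> Lambda1" and L2: "\<bar>k\<bar> \<ge> 2 \<Longrightarrow> G \<in> Lambda2"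
  obtains g1 g2 N where "finite_energy g g1 g2 N \<bar>real_of_int k\<bar>"
    "\<And>x. x > 0 \<Longrightarrow> vderiv G x = complex_of_real (g1 x)"
    "energy_norm k G = sqrt (integral {0<..} (\<lambda>x. energy_density \<bar>real_of_int k\<bar> x (g x) (g1 x) (g2 x)))"
proof -
  define \<kappa> where "\<kappa> = \<bar>real_of_int k\<bar>"
  have \<kappa>_int: "\<kappa> = real_of_int \<bar>k\<bar>" unfolding \<kappa>_def by simp
  have cases: "\<bar>k\<bar> = 1 \<or> \<bar>k\<bar> \<ge> 2" using k by linarith
  then have \<kappa>: "\<kappa> = 1 \<or> \<kappa> \<ge> 2" unfolding \<kappa>_int by (metis of_int_1 of_int_le_iff of_int_numeral)
  have \<kappa>2: "\<kappa>\<^sup>2 = (real_of_int k)\<^sup>2" unfolding \<kappa>_def by simp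
  have C1: "G C1_differentiable_on {0<..}" and AC: "vderiv G \<in> AC_loc"
    and L2A: "(\<lambda>x. (x powr (1/2)) *\<^sub>R vderiv (vderiv G) x) \<in> L2_on {0<..}"
    using cases L1 L2 unfolding Lambda1_def Lambda2_def by (auto simp: numeral_2_eq_2)
  have meas0: "{0<..} \<in> sets (lebesgue :: real measure)" by simp
  define g1 where "g1 x = Re (vderiv G x)" for x
  define g2 where "g2 x = Re (vderiv (vderiv G) x)" for x
  have dG: "(G has_vector_derivative vderiv G x) (at x)" if "x > 0" for x
  proof -
    obtain D where "\<forall>x\<in>{0<..}. (G has_vector_derivative D x) (at x)"
      using C1 unfolding C1_differentiable_on_def by blast
    then have "(G has_vector_derivative D x) (at x)" using that by auto
    then show ?thesis unfolding vderiv_def by (simp add: vector_derivative_at)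
  qed
  have dg: "(g has_real_derivative g1 x) (at x)" if "x > 0" for x
    using dG[OF that] unfolding has_vector_derivative_complex_iff g1_def G_def by simp
  have G1: "vderiv G x = complex_of_real (g1 x)" if "x > 0" for x
    using has_vector_derivative_of_real[OF dg[OF that], where 'a=complex]
    unfolding G_def[symmetric] vderiv_def by (rule vector_derivative_at)
  have acg1: "abs_cont g1 a b" if "0 < a" "a < b" for a b
    by (rule AC_on_imp_abs_cont[of "vderiv G"]) (use AC that in \<open>auto simp: AC_loc_def g1_def\<close>)
  \<comment> \<open>Absolute continuity gives derivatives almost everywhere on compact intervals;
    these intervals exhaust (0, \<infinity>), the one for \<open>m = 0\<close> being empty.\<close>
  have "\<exists>N. negligible N \<and> (\<forall>x\<in>{1 / Suc m<..<real (Suc m)} - N. \<exists>d. (g1 has_real_derivative d) (at x))" for m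
  proof (cases "m = 0")
    case True
    then show ?thesis by (intro exI[of _ "{}"]) auto
  next
    case False
    then have "1 / Suc m < real (Suc m)" by (simp add: field_simps add_pos_pos)
    then show ?thesis
      using abs_cont_differentiable_ae[OF acg1[of "1 / Suc m" "real (Suc m)"]] by (metis divide_pos_pos less_imp_le of_nat_0_less_iff zero_less_Suc zero_less_one)
  qed
  then obtain N' where N': "\<And>m. negligible (N' m)"
      "\<And>m x. x \<in> {1 / Suc m<..<real (Suc m)} - N' m \<Longrightarrow> \<exists>d. (g1 has_real_derivative d) (at x)"
    by metis
  define N where "N = (\<Union>m. N' m)"
  have N: "negligible N" unfolding N_def by (rule negligible_Union_nat) (rule N')
  have dg1: "(g1 has_real_derivative g2 x) (at x)" and G2: "vderiv (vderiv G) x = complex_of_real (g2 x)"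
    if x: "x > 0" "x \<notin> N" for x
  proof -
    define m where "m = nat \<lceil>max x (1 / x)\<rceil>"
    have "max x (1 / x) < real (Suc m)"
      unfolding m_def using x(1) by linarith
    then have "1 / Suc m < x" "x < real (Suc m)" using x(1) by (auto simp: field_simps)
    then obtain d where d: "(g1 has_real_derivative d) (at x)"
      using N'(2)[of x m] x(2) unfolding N_def by auto
    have "((\<lambda>y. complex_of_real (g1 y)) has_vector_derivative complex_of_real d) (at x)"
      by (rule has_vector_derivative_of_real[OF d])
    then have "(vderiv G has_vector_derivative complex_of_real d) (at x)"
      by (rule has_vector_derivative_transform_within_open[of _ _ _ "{0<..}"]) (use x(1) G1 in auto)
    then have *: "vderiv (vderiv G) x = complex_of_real d"
      unfolding vderiv_def[of "vderiv G"] by (rule vector_derivative_at)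
    then have "g2 x = d" unfolding g2_def by simp
    then show "(g1 has_real_derivative g2 x) (at x)" "vderiv (vderiv G) x = complex_of_real (g2 x)"
      using d * by auto
  qed
  \<comment> \<open>In the weighted functions \<open>P\<close>, \<open>Q\<close>, \<open>A\<close>
    of the data spaces, the energy density and the boundary forms divided by x become quadratic
    forms with constant coefficients.\<close>
  define P where "P x = x powr (-1/2) * g1 x" for x
  define Q where "Q x = x powr (-3/2) * g x" for x
  define A where "A x = x powr (1/2) * g2 x" for x
  have sqA: "square_integrable {0<..} A"
    by (rule L2_on_Re[OF L2A meas0]) (simp add: A_def g2_def)
  have g2_meas: "g2 \<in> borel_measurable (lebesgue_on {0<..})"
  proof -
    have "(\<lambda>x::real. x powr (-1/2)) \<in> borel_measurable (lebesgue_on {0<..})"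
      by (intro continuous_imp_measurable_on_sets_lebesgue continuous_intros) auto
    moreover have "A \<in> borel_measurable (lebesgue_on {0<..})" using sqA unfolding square_integrable_def by simp
    ultimately have "(\<lambda>x. x powr (-1/2) * A x) \<in> borel_measurable (lebesgue_on {0<..})"
      by (rule borel_measurable_times)
    then show ?thesis
      by (rule measurable_cong[THEN iffD2, rotated]) (auto simp: A_def mult.assoc[symmetric] powr_add[symmetric])
  qed
  define c0 where "c0 x = 2 * \<kappa>\<^sup>2 * (Q x - P x)\<^sup>2 + (\<kappa>\<^sup>2 * Q x - P x)\<^sup>2" for x
  have V_eq: "boundary_form c x (g x) (g1 x) / x
      = (2 * c + 1) * (P x)\<^sup>2 - 2 * c * (c + 2) * (Q x * P x) + (2 * c ^ 3 + c\<^sup>2) * (Q x)\<^sup>2"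
    if "x > 0" for x c
  proof -
    define y where "y = x powr (-1/2)"
    have y: "y\<^sup>2 = 1 / x" "P x = y * g1 x" "Q x = y / x * g x"
      using powr_half_squares[OF that] unfolding y_def P_def Q_def by simp_all
    have "(P x)\<^sup>2 = y\<^sup>2 * (g1 x)\<^sup>2" "Q x * P x = y\<^sup>2 * (g x * g1 x / x)" "(Q x)\<^sup>2 = y\<^sup>2 * ((g x)\<^sup>2 / x\<^sup>2)"
      unfolding y(2,3) by (simp_all add: power_mult_distrib power_divide power2_eq_square)
    then show ?thesis
      unfolding boundary_form_def y(1) using that by (simp add: add_divide_distrib diff_divide_distrib mult_ac)
  qed
  have c0_eq: "c0 x = (2 * \<kappa>\<^sup>2 * (g x / x\<^sup>2 - g1 x / x)\<^sup>2 + (\<kappa>\<^sup>2 * g x / x\<^sup>2 - g1 x / x)\<^sup>2) * x"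
    if "x > 0" for x
  proof -
    define y where "y = x powr (-1/2)"
    have y: "y\<^sup>2 = 1 / x" "P x = y * x * (g1 x / x)" "Q x = y * x * (g x / x\<^sup>2)"
      using powr_half_squares[OF that] that unfolding y_def P_def Q_def by (simp_all add: power2_eq_square)
    have yx: "(y * x)\<^sup>2 = x" unfolding power_mult_distrib y(1) using that by (simp add: power2_eq_square)
    have "c0 x = (y * x)\<^sup>2 * (2 * \<kappa>\<^sup>2 * (g x / x\<^sup>2 - g1 x / x)\<^sup>2 + (\<kappa>\<^sup>2 * g x / x\<^sup>2 - g1 x / x)\<^sup>2)"
      unfolding c0_def y(2,3) by (simp add: power2_eq_square algebra_simps)
    then show ?thesis unfolding yx by (simp add: mult.commute)
  qed
  \<comment> \<open>For |k| = 1 only \<open>P - Q\<close> is square integrable, and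
    \<open>c0\<close> and the forms are multiples of its square; otherwise \<open>P\<close> and
    \<open>Q\<close> are square integrable separately.\<close>
  have int: "integrable (lebesgue_on {0<..}) c0 \<and>
      (\<forall>c. c = \<kappa> \<or> c = - \<kappa> \<longrightarrow> integrable (lebesgue_on {0<..})
        (\<lambda>x. (2 * c + 1) * (P x)\<^sup>2 - 2 * c * (c + 2) * (Q x * P x) + (2 * c ^ 3 + c\<^sup>2) * (Q x)\<^sup>2))"
  proof (cases "\<bar>k\<bar> = 1")
    case True
    then have \<kappa>1: "\<kappa> = 1" unfolding \<kappa>_def by linarith
    have "(\<lambda>r. (r powr (-1/2)) *\<^sub>R vderiv G r - (r powr (-3/2)) *\<^sub>R G r) \<in> L2_on {0<..}"
      using L1[OF True] unfolding Lambda1_def by simp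
    then have "square_integrable {0<..} (\<lambda>x. P x - Q x)"
      by (rule L2_on_Re[OF _ meas0]) (simp add: P_def Q_def g1_def G_def)
    then have "integrable (lebesgue_on {0<..}) (\<lambda>x. (P x - Q x)\<^sup>2)" unfolding square_integrable_def by simp
    moreover have "c0 = (\<lambda>x. 3 * (P x - Q x)\<^sup>2)"
      unfolding c0_def \<kappa>1 by (auto simp: power2_eq_square algebra_simps)
    moreover have "(\<lambda>x. (2 * c + 1) * (P x)\<^sup>2 - 2 * c * (c + 2) * (Q x * P x) + (2 * c ^ 3 + c\<^sup>2) * (Q x)\<^sup>2)
      = (\<lambda>x. (2 * c + 1) * (P x - Q x)\<^sup>2)" if "c = 1 \<or> c = - 1" for c
      using that by (auto simp: power2_eq_square algebra_simps)
    ultimately show ?thesis unfolding \<kappa>1 by simp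
  next
    case False
    then have "\<bar>k\<bar> \<ge> 2" using cases by simp
    from L2[OF this] have "(\<lambda>r. (r powr (-1/2)) *\<^sub>R vderiv G r) \<in> L2_on {0<..}" "(\<lambda>r. (r powr (-3/2)) *\<^sub>R G r) \<in> L2_on {0<..}"
      unfolding Lambda2_def by simp_all
    from this[THEN L2_on_Re[OF _ meas0]] have "square_integrable {0<..} P" "square_integrable {0<..} Q"
      by (simp_all add: P_def Q_def g1_def G_def)
    then have PQ: "integrable (lebesgue_on {0<..}) (\<lambda>x. (P x)\<^sup>2)" "integrable (lebesgue_on {0<..}) (\<lambda>x. (Q x)\<^sup>2)"
        "integrable (lebesgue_on {0<..}) (\<lambda>x. Q x * P x)"
      using square_integrable_prod unfolding square_integrable_def by auto
    have "c0 = (\<lambda>x. (2 * \<kappa>\<^sup>2 + 1) * (P x)\<^sup>2 + (2 * \<kappa>\<^sup>2 + \<kappa>\<^sup>2 * \<kappa>\<^sup>2) * (Q x)\<^sup>2 - 6 * \<kappa>\<^sup>2 * (Q x * P x))"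
      unfolding c0_def by (auto simp: power2_eq_square algebra_simps)
    then show ?thesis using PQ by auto
  qed
  have E_eq: "energy_density \<kappa> x (g x) (g1 x) (g2 x) = (A x)\<^sup>2 + c0 x" if "x > 0" for x
    unfolding energy_density_def A_def c0_eq[OF that] power_mult_distrib powr_half_squares(1)[OF that]
    by (simp add: algebra_simps)
  have E_int: "(\<lambda>x. energy_density \<kappa> x (g x) (g1 x) (g2 x)) integrable_on {0<..}"
  proof -
    have "integrable (lebesgue_on {0<..}) (\<lambda>x. (A x)\<^sup>2 + c0 x)"
      using sqA int unfolding square_integrable_def by auto
    then have "(\<lambda>x. (A x)\<^sup>2 + c0 x) integrable_on {0<..}" by (rule integrable_on_lebesgue_on) simp
    then show ?thesis by (rule integrable_eq) (simp add: E_eq)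
  qed
  have fe: "finite_energy g g1 g2 N \<kappa>"
  proof
    fix c assume c: "c = \<kappa> \<or> c = - \<kappa>"
    from int c have "integrable (lebesgue_on {0<..})
        (\<lambda>x. \<bar>(2 * c + 1) * (P x)\<^sup>2 - 2 * c * (c + 2) * (Q x * P x) + (2 * c ^ 3 + c\<^sup>2) * (Q x)\<^sup>2\<bar>)"
      by (intro Bochner_Integration.integrable_abs) blast
    then have "(\<lambda>x. \<bar>(2 * c + 1) * (P x)\<^sup>2 - 2 * c * (c + 2) * (Q x * P x) + (2 * c ^ 3 + c\<^sup>2) * (Q x)\<^sup>2\<bar>) integrable_on {0<..}"
      by (rule integrable_on_lebesgue_on) simp
    then show "(\<lambda>x. \<bar>boundary_form c x (g x) (g1 x)\<bar> / x) integrable_on {0<..}"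
    proof (rule integrable_eq)
      fix x :: real assume "x \<in> {0<..}"
      then have x: "x > 0" by simp
      show "\<bar>(2 * c + 1) * (P x)\<^sup>2 - 2 * c * (c + 2) * (Q x * P x) + (2 * c ^ 3 + c\<^sup>2) * (Q x)\<^sup>2\<bar>
        = \<bar>boundary_form c x (g x) (g1 x)\<bar> / x"
        unfolding V_eq[OF x, symmetric] using x by simp
    qed
  qed (use \<kappa> dg acg1 N dg1 g2_meas E_int in auto)
  have norm: "energy_norm k G = sqrt (integral {0<..} (\<lambda>x. energy_density \<kappa> x (g x) (g1 x) (g2 x)))"
  proof -
    let ?en = "\<lambda>r. ((norm ((vderiv ^^ 2) G r))\<^sup>2
        + 2 * (real_of_int k)\<^sup>2 * (norm ((1 / r\<^sup>2) *\<^sub>R G r - (1 / r) *\<^sub>R vderiv G r))\<^sup>2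
        + (norm (((real_of_int k)\<^sup>2 / r\<^sup>2) *\<^sub>R G r - (1 / r) *\<^sub>R vderiv G r))\<^sup>2) * r"
    have en: "?en x = (norm ((x powr (1/2)) *\<^sub>R vderiv (vderiv G) x))\<^sup>2 + c0 x" if x: "x > 0" for x
    proof -
      have Gx: "G x = complex_of_real (g x)" unfolding G_def ..
      have "(1 / x\<^sup>2) *\<^sub>R G x - (1 / x) *\<^sub>R vderiv G x = complex_of_real (g x / x\<^sup>2 - g1 x / x)"
        "((real_of_int k)\<^sup>2 / x\<^sup>2) *\<^sub>R G x - (1 / x) *\<^sub>R vderiv G x = complex_of_real (\<kappa>\<^sup>2 * g x / x\<^sup>2 - g1 x / x)"
        unfolding G1[OF x] Gx \<kappa>2 by (simp_all add: scaleR_conv_of_real)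
      then show ?thesis
        unfolding c0_eq[OF x] norm_scaleR power_mult_distrib \<kappa>2
        using powr_half_squares(1)[OF x] x by (simp add: numeral_2_eq_2 algebra_simps del: of_real_diff of_real_divide of_real_mult of_real_power)
    qed
    have "integrable (lebesgue_on {0<..}) (\<lambda>x. (norm ((x powr (1/2)) *\<^sub>R vderiv (vderiv G) x))\<^sup>2 + c0 x)"
      using L2A int unfolding L2_on_def by auto
    then have "integrable (lebesgue_on {0<..}) ?en"
      by (rule Bochner_Integration.integrable_cong[THEN iffD2, rotated -1]) (auto simp: en simp del: funpow.simps)
    then have "(LINT r|lebesgue_on {0<..}. ?en r) = integral {0<..} ?en"
      by (rule lebesgue_integral_eq_integral) simp
    \<comment> \<open>Off \<open>N\<close> the second derivative is real and equals
      \<open>g2\<close>; on \<open>N\<close> the two integrands may differ.\<close>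
    also have "\<dots> = integral {0<..} (\<lambda>x. energy_density \<kappa> x (g x) (g1 x) (g2 x))"
    proof (rule integral_spike[OF N])
      fix x assume "x \<in> {0<..} - N"
      then have x: "x > 0" "x \<notin> N" by auto
      show "energy_density \<kappa> x (g x) (g1 x) (g2 x) = ?en x"
        unfolding en[OF x(1)] E_eq[OF x(1)] G2[OF x] A_def by (simp add: power_mult_distrib)
    qed
    finally show ?thesis unfolding energy_norm_def Let_def by simp
  qed
  show thesis using that[of g1 g2 N] fe G1 norm unfolding \<kappa>_def by blast
qed

text \<open>The data interpolated by the imaginary part of the spline.\<close>

lemma finite_energy_zero:
  assumes "k = 1 \<or> k \<ge> 2"
  shows "finite_energy (\<lambda>_. 0) (\<lambda>_. 0) (\<lambda>_. 0) {} k"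
proof
  show "abs_cont (\<lambda>_. 0) a b" for a b by (rule abs_cont_C1[of _ _ _ "\<lambda>_. 0"]) auto
qed (use assms in \<open>auto simp: energy_density_def boundary_form_def intro: integrable_0\<close>)

section \<open>Real components of a Beppo Levi spline\<close>

context
  fixes k :: int and n :: nat and r :: "nat \<Rightarrow> real" and \<sigma> :: "real \<Rightarrow> complex"
  assumes spline: "\<sigma> \<in> BL_splines k n r" and n: "2 \<le> n" and r1: "0 < r 1" and r_mono: "strict_mono_on {1..n} r"
begin

lemma spline_piece_derivative:
  assumes "j \<in> {1..<n}" "x \<in> {r j<..<r (Suc j)}" "m < 4"
  shows "((vderiv ^^ m) \<sigma> has_vector_derivative (vderiv ^^ Suc m) \<sigma> x) (at x)"
proof -
  have "(vderiv ^^ m) \<sigma> differentiable (at x)"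
    using spline assms unfolding BL_splines_def Cn_on_def by auto
  then show ?thesis by (simp add: vector_derivative_works vderiv_def)
qed

lemma spline_knot:
  assumes "j \<in> {1..n}"
  shows "m < 2 \<Longrightarrow> ((vderiv ^^ m) \<sigma> has_vector_derivative (vderiv ^^ Suc m) \<sigma> (r j)) (at (r j))"
    "m \<le> 2 \<Longrightarrow> isCont ((vderiv ^^ m) \<sigma>) (r j)"
proof -
  obtain e where e: "e > 0" "Cn_on 2 \<sigma> {r j - e<..<r j + e}"
    using spline assms unfolding BL_splines_def by blast
  have mem: "r j \<in> {r j - e<..<r j + e}" using e(1) by auto
  have diff: "(vderiv ^^ m) \<sigma> differentiable (at (r j))" if "m < 2" for m
    using e(2) mem that unfolding Cn_on_def by blast
  show "m < 2 \<Longrightarrow> ((vderiv ^^ m) \<sigma> has_vector_derivative (vderiv ^^ Suc m) \<sigma> (r j)) (at (r j))"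
    using diff[of m] by (simp add: vector_derivative_works vderiv_def)
  show "m \<le> 2 \<Longrightarrow> isCont ((vderiv ^^ m) \<sigma>) (r j)"
  proof (cases "m = 2")
    case True
    then show ?thesis
      using e(2) mem unfolding Cn_on_def by (auto simp: continuous_on_eq_continuous_at simp del: greaterThanLessThan_iff)
  next
    case False
    assume "m \<le> 2"
    with False show ?thesis using diff[of m] differentiable_imp_continuous_within by (metis le_neq_implies_less)
  qed
qed

lemma spline_derivative:
  assumes "x \<in> {r 1..r n}" "m < 2"
  shows "((vderiv ^^ m) \<sigma> has_vector_derivative (vderiv ^^ Suc m) \<sigma> x) (at x)"
proof -
  obtain j where j: "j \<in> {1..<n}" "x \<in> {r j..r (Suc j)}" using knot_interval_cover[OF n assms(1)] .
  consider "x = r j" | "x = r (Suc j)" | "x \<in> {r j<..<r (Suc j)}" using j by force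
  then show ?thesis
    using spline_knot(1)[of j m] spline_knot(1)[of "Suc j" m] spline_piece_derivative[of j x m] j assms(2)
    by cases auto
qed

lemma spline_second_derivative_continuous: "continuous_on {r 1..r n} ((vderiv ^^ 2) \<sigma>)"
proof (intro continuous_at_imp_continuous_on ballI)
  fix x assume "x \<in> {r 1..r n}"
  then obtain j where j: "j \<in> {1..<n}" "x \<in> {r j..r (Suc j)}" by (rule knot_interval_cover[OF n])
  consider "x = r j" | "x = r (Suc j)" | "x \<in> {r j<..<r (Suc j)}" using j by force
  then show "isCont ((vderiv ^^ 2) \<sigma>) x"
  proof cases
    case 3
    then show ?thesis
      using has_vector_derivative_continuous spline_piece_derivative[OF j(1), of x 2] by auto
  qed (use spline_knot(2)[of j 2] spline_knot(2)[of "Suc j" 2] j in auto)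
qed

text \<open>The equation for G_k holds to the left of r_1 only; C^2 continuity carries it to the
  knot in the limit. The right condition is its mirror image.\<close>

lemma spline_left_condition:
  defines "c \<equiv> \<bar>real_of_int k\<bar>"
  shows "(vderiv ^^ 2) \<sigma> (r 1) - ((2 * c + 1) / r 1) *\<^sub>R vderiv \<sigma> (r 1) + (c * (c + 2) / (r 1)\<^sup>2) *\<^sub>R \<sigma> (r 1) = 0"
proof -
  let ?F = "\<lambda>x. (vderiv ^^ 2) \<sigma> x - ((2 * c + 1) / x) *\<^sub>R vderiv \<sigma> x + (c * (c + 2) / x\<^sup>2) *\<^sub>R \<sigma> x"
  have "isCont ?F (r 1)"
    using spline_knot(2)[of 1 0] spline_knot(2)[of 1 1] spline_knot(2)[of 1 2] n r1
    by (intro continuous_intros) auto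
  then have "(?F \<longlongrightarrow> ?F (r 1)) (at_left (r 1))"
    unfolding isCont_def by (rule filterlim_mono) (auto simp: at_le)
  moreover have "?F x = 0" if x: "x \<in> {0<..<r 1}" for x
  proof -
    have "G_op k \<sigma> x = 0" using spline x unfolding BL_splines_def by blast
    then show ?thesis using x unfolding G_op_def Let_def c_def by simp
  qed
  then have "\<forall>\<^sub>F x in at_left (r 1). ?F x = 0"
    using eventually_at_left_real[OF r1] by (auto elim: eventually_mono)
  then have "(?F \<longlongrightarrow> 0) (at_left (r 1))" by (rule tendsto_eventually)
  ultimately show ?thesis using tendsto_unique trivial_limit_at_left_real by blast
qed

lemma spline_right_condition:
  defines "c \<equiv> \<bar>real_of_int k\<bar>"
  shows "(vderiv ^^ 2) \<sigma> (r n) + ((2 * c - 1) / r n) *\<^sub>R vderiv \<sigma> (r n) + (c * (c - 2) / (r n)\<^sup>2) *\<^sub>R \<sigma> (r n) = 0"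
proof -
  let ?F = "\<lambda>x. (vderiv ^^ 2) \<sigma> x + ((2 * c - 1) / x) *\<^sub>R vderiv \<sigma> x + (c * (c - 2) / x\<^sup>2) *\<^sub>R \<sigma> x"
  have "r 1 < r n" using n by (intro strict_mono_onD[OF r_mono]) auto
  with r1 have rn: "0 < r n" by linarith
  have "isCont ?F (r n)"
    using spline_knot(2)[of n 0] spline_knot(2)[of n 1] spline_knot(2)[of n 2] n rn
    by (intro continuous_intros) auto
  then have "(?F \<longlongrightarrow> ?F (r n)) (at_right (r n))"
    unfolding isCont_def by (rule filterlim_mono) (auto simp: at_le)
  moreover have "?F x = 0" if x: "x > r n" for x
  proof -
    have "R_op k \<sigma> x = 0" using spline x unfolding BL_splines_def by blast
    then show ?thesis using x rn unfolding R_op_def Let_def c_def by simp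
  qed
  then have "\<forall>\<^sub>F x in at_right (r n). ?F x = 0"
    unfolding eventually_at_right_field by (intro exI[of _ "r n + 1"]) auto
  then have "(?F \<longlongrightarrow> 0) (at_right (r n))" by (rule tendsto_eventually)
  ultimately show ?thesis using tendsto_unique trivial_limit_at_right_real by blast
qed

lemma spline_ode:
  assumes "j \<in> {1..<n}" "x \<in> {r j<..<r (Suc j)}"
  shows "x *\<^sub>R (vderiv ^^ 4) \<sigma> x + 2 *\<^sub>R (vderiv ^^ 3) \<sigma> x
    - ((2 * \<bar>real_of_int k\<bar>\<^sup>2 + 1) / x) *\<^sub>R (vderiv ^^ 2) \<sigma> x
    + ((2 * \<bar>real_of_int k\<bar>\<^sup>2 + 1) / x\<^sup>2) *\<^sub>R vderiv \<sigma> x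
    + ((\<bar>real_of_int k\<bar> ^ 4 - 4 * \<bar>real_of_int k\<bar>\<^sup>2) / x ^ 3) *\<^sub>R \<sigma> x = 0"
proof -
  have "L_op k \<sigma> x = 0" using spline assms unfolding BL_splines_def by blast
  moreover have "\<bar>real_of_int k\<bar> ^ 4 = real_of_int k ^ 4" by (simp add: power_even_abs)
  ultimately show ?thesis unfolding L_op_def Let_def by simp
qed

text \<open>All equations have real coefficients, so they survive any bounded real-linear
  functional; it is applied to the real and imaginary parts.\<close>

lemma spline_interpolation_component:
  fixes \<phi> :: "complex \<Rightarrow> real"
  assumes \<phi>: "bounded_linear \<phi>" and fe: "finite_energy g0 g1 g2 N \<bar>real_of_int k\<bar>"
    and interp: "\<And>j. j \<in> {1..n} \<Longrightarrow> \<phi> (\<sigma> (r j)) = g0 (r j)"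
  shows "spline_interpolation g0 g1 g2 N \<bar>real_of_int k\<bar> n r (\<lambda>x. \<phi> (\<sigma> x)) (\<lambda>x. \<phi> (vderiv \<sigma> x))
    (\<lambda>x. \<phi> ((vderiv ^^ 2) \<sigma> x)) (\<lambda>x. \<phi> ((vderiv ^^ 3) \<sigma> x)) (\<lambda>x. \<phi> ((vderiv ^^ 4) \<sigma> x))"
proof -
  interpret \<phi>: bounded_linear \<phi> by (rule \<phi>)
  interpret finite_energy g0 g1 g2 N "\<bar>real_of_int k\<bar>" by (rule fe)
  have deriv: "((\<lambda>x. \<phi> (f x)) has_real_derivative \<phi> d) (at x)" if "(f has_vector_derivative d) (at x)" for f d x
    using \<phi>.has_vector_derivative[OF that] by (simp add: has_real_derivative_iff_has_vector_derivative)
  have lin: "\<phi> (a *\<^sub>R z) = a * \<phi> z" for a z by (simp add: \<phi>.scaleR)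
  show ?thesis
  proof
    fix x assume "x \<in> {r 1..r n}"
    from deriv[OF spline_derivative[OF this, of 0]] deriv[OF spline_derivative[OF this, of 1]]
    show "((\<lambda>x. \<phi> (\<sigma> x)) has_real_derivative \<phi> (vderiv \<sigma> x)) (at x)"
      "((\<lambda>x. \<phi> (vderiv \<sigma> x)) has_real_derivative \<phi> ((vderiv ^^ 2) \<sigma> x)) (at x)"
      by (simp_all add: numeral_2_eq_2)
  next
    show "continuous_on {r 1..r n} (\<lambda>x. \<phi> ((vderiv ^^ 2) \<sigma> x))"
      by (rule \<phi>.continuous_on[OF spline_second_derivative_continuous])
  next
    fix j x assume jx: "j \<in> {1..<n}" "x \<in> {r j<..<r (Suc j)}"
    from deriv[OF spline_piece_derivative[OF jx, of 2]] deriv[OF spline_piece_derivative[OF jx, of 3]]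
    show "((\<lambda>x. \<phi> ((vderiv ^^ 2) \<sigma> x)) has_real_derivative \<phi> ((vderiv ^^ 3) \<sigma> x)) (at x)"
      "((\<lambda>x. \<phi> ((vderiv ^^ 3) \<sigma> x)) has_real_derivative \<phi> ((vderiv ^^ 4) \<sigma> x)) (at x)"
      by (simp_all add: eval_nat_numeral)
    from arg_cong[OF spline_ode[OF jx], of \<phi>]
    show "x * \<phi> ((vderiv ^^ 4) \<sigma> x) + 2 * \<phi> ((vderiv ^^ 3) \<sigma> x)
      - (2 * \<bar>real_of_int k\<bar>\<^sup>2 + 1) / x * \<phi> ((vderiv ^^ 2) \<sigma> x)
      + (2 * \<bar>real_of_int k\<bar>\<^sup>2 + 1) / x\<^sup>2 * \<phi> (vderiv \<sigma> x)
      + (\<bar>real_of_int k\<bar> ^ 4 - 4 * \<bar>real_of_int k\<bar>\<^sup>2) / x ^ 3 * \<phi> (\<sigma> x) = 0"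
      unfolding \<phi>.add \<phi>.diff lin \<phi>.zero .
  next
    from arg_cong[OF spline_left_condition, of \<phi>]
    show "\<phi> ((vderiv ^^ 2) \<sigma> (r 1)) - (2 * \<bar>real_of_int k\<bar> + 1) / r 1 * \<phi> (vderiv \<sigma> (r 1))
      + \<bar>real_of_int k\<bar> * (\<bar>real_of_int k\<bar> + 2) / (r 1)\<^sup>2 * \<phi> (\<sigma> (r 1)) = 0"
      unfolding \<phi>.add \<phi>.diff lin \<phi>.zero .
    from arg_cong[OF spline_right_condition, of \<phi>]
    show "\<phi> ((vderiv ^^ 2) \<sigma> (r n)) + (2 * \<bar>real_of_int k\<bar> - 1) / r n * \<phi> (vderiv \<sigma> (r n))
      + \<bar>real_of_int k\<bar> * (\<bar>real_of_int k\<bar> - 2) / (r n)\<^sup>2 * \<phi> (\<sigma> (r n)) = 0"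
      unfolding \<phi>.add \<phi>.diff lin \<phi>.zero .
  qed (use n r1 r_mono interp in auto)
qed

end

text \<open>\<open>L2_norm\<close> is infinite outside \<open>L2_on\<close>, so measurability and
  square integrability are part of the claim; both follow from continuity on [a, b].\<close>

lemma norms_le:
  fixes F :: "real \<Rightarrow> real"
  assumes F: "continuous_on {a..b} F" and f: "\<And>x. x \<in> {a..b} \<Longrightarrow> f x = complex_of_real (F x)"
    and B: "\<And>x. x \<in> {a..b} \<Longrightarrow> \<bar>F x\<bar> \<le> B"
    and C: "integral {a..b} (\<lambda>x. (F x)\<^sup>2) \<le> C\<^sup>2" "0 \<le> C"
  shows "Linf_norm {a..b} f \<le> ereal B" "L2_norm {a..b} f \<le> ereal C"
proof -
  have f_cont: "continuous_on {a..b} f"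
    by (rule continuous_on_eq[of _ "\<lambda>x. complex_of_real (F x)"]) (auto intro!: continuous_intros F simp: f)
  have f_meas[measurable]: "f \<in> borel_measurable (lebesgue_on {a..b})"
    by (rule continuous_imp_measurable_on_sets_lebesgue[OF f_cont]) simp
  show "Linf_norm {a..b} f \<le> ereal B"
    unfolding Linf_norm_def
  proof (rule esssup_I)
    show "(\<lambda>x. ereal (norm (f x))) \<in> borel_measurable (lebesgue_on {a..b})" by measurable
    show "AE x in lebesgue_on {a..b}. ereal (norm (f x)) \<le> ereal B"
      using B f by (intro AE_I2) simp
  qed
  have int: "integrable (lebesgue_on {a..b}) (\<lambda>x. (norm (f x))\<^sup>2)"
    by (rule continuous_imp_integrable_real) (intro continuous_intros f_cont)
  then have "(LINT x|lebesgue_on {a..b}. (norm (f x))\<^sup>2) = integral {a..b} (\<lambda>x. (norm (f x))\<^sup>2)"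
    by (rule lebesgue_integral_eq_integral) simp
  also have "\<dots> = integral {a..b} (\<lambda>x. (F x)\<^sup>2)"
    by (rule integral_cong) (simp add: f)
  also note C(1)
  finally have "sqrt (LINT x|lebesgue_on {a..b}. (norm (f x))\<^sup>2) \<le> C"
    using C(2) real_le_lsqrt by (metis real_sqrt_le_iff real_sqrt_abs abs_of_nonneg)
  then show "L2_norm {a..b} f \<le> ereal C"
    unfolding L2_norm_def using int f_meas by (simp add: L2_on_def)
qed

theorem theorem5:
  fixes n :: nat and r :: "nat \<Rightarrow> real" and k :: int and g :: "real \<Rightarrow> real"
    and \<sigma> :: "real \<Rightarrow> complex" and h :: real and m :: nat
  assumes "n \<ge> 2" and "0 < r 1" and "strict_mono_on {1..n} r"
    and "h = (MAX j\<in>{1..n-1}. r (j + 1) - r j)"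
    and "k \<noteq> 0"
    and "\<bar>k\<bar> = 1 \<Longrightarrow> (\<lambda>x. complex_of_real (g x)) \<in> Lambda1"
    and "\<bar>k\<bar> \<ge> 2 \<Longrightarrow> (\<lambda>x. complex_of_real (g x)) \<in> Lambda2"
    and "\<sigma> \<in> BL_splines k n r"
    and "\<forall>j\<in>{1..n}. \<sigma> (r j) = complex_of_real (g (r j))"
    and "m \<in> {0, 1}"
  shows "Linf_norm {r 1..r n} ((vderiv ^^ m) (\<lambda>x. complex_of_real (g x) - \<sigma> x))
           \<le> ereal (1 / (2 powr (1 - real m) * sqrt (r 1)) * h powr (3/2 - real m)
                      * energy_norm k (\<lambda>x. complex_of_real (g x)))
       \<and> L2_norm {r 1..r n} ((vderiv ^^ m) (\<lambda>x. complex_of_real (g x) - \<sigma> x))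
           \<le> ereal (1 / (2 powr (1 - real m) * sqrt (r 1)) * h powr (2 - real m)
                      * energy_norm k (\<lambda>x. complex_of_real (g x)))"
proof -
  let ?G = "\<lambda>x. complex_of_real (g x)" and ?k = "\<bar>real_of_int k\<bar>"
  obtain g1 g2 N where fe: "finite_energy g g1 g2 N ?k"
    and G1: "\<And>x. x > 0 \<Longrightarrow> vderiv ?G x = complex_of_real (g1 x)"
    and en: "energy_norm k ?G = sqrt (integral {0<..} (\<lambda>x. energy_density ?k x (g x) (g1 x) (g2 x)))"
    using Lambda_finite_energy[OF assms(5) assms(6,7)] by blast
  interpret fe: finite_energy g g1 g2 N ?k by (rule fe)
  define T where "T = integral {0<..} fe.E"
  have T: "0 \<le> T" unfolding T_def
    by (intro integral_nonneg fe.energy) (auto intro: energy_density_nonneg)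
  interpret R: spline_interpolation g g1 g2 N ?k n r "\<lambda>x. Re (\<sigma> x)" "\<lambda>x. Re (vderiv \<sigma> x)"
      "\<lambda>x. Re ((vderiv ^^ 2) \<sigma> x)" "\<lambda>x. Re ((vderiv ^^ 3) \<sigma> x)" "\<lambda>x. Re ((vderiv ^^ 4) \<sigma> x)"
    by (rule spline_interpolation_component[OF assms(8) assms(1-3) bounded_linear_Re fe]) (use assms(9) in simp)
  txt \<open>The imaginary part of the spline interpolates \<open>0\<close>, whose energy is \<open>0\<close>; hence it vanishes.\<close>
  interpret I: spline_interpolation "\<lambda>_. 0" "\<lambda>_. 0" "\<lambda>_. 0" "{}" ?k n r "\<lambda>x. Im (\<sigma> x)" "\<lambda>x. Im (vderiv \<sigma> x)"
      "\<lambda>x. Im ((vderiv ^^ 2) \<sigma> x)" "\<lambda>x. Im ((vderiv ^^ 3) \<sigma> x)" "\<lambda>x. Im ((vderiv ^^ 4) \<sigma> x)"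
    by (rule spline_interpolation_component[OF assms(8) assms(1-3) bounded_linear_Im finite_energy_zero[OF fe.k]])
      (use assms(9) in simp)
  have h: "r (Suc j) - r j \<le> h" if "j \<in> {1..<n}" for j
    unfolding assms(4) using that by (intro Max_ge) (auto intro!: image_eqI[of _ _ j])
  have h0: "h > 0" using h[of 1] R.knots(2)[of 1] assms(1) by force
  have IT: "integral {0<..} (\<lambda>x. energy_density ?k x 0 0 0) = 0"
    by (simp add: energy_density_def)
  have Im0: "Im (\<sigma> x) = 0" "Im (vderiv \<sigma> x) = 0" if "x \<in> {r 1..r n}" for x
    using I.uniform_bounds[of h, OF h that] unfolding IT by simp_all
  have err0: "?G x - \<sigma> x = complex_of_real (g x - Re (\<sigma> x))" if "x \<in> {r 1..r n}" for x
    using Im0(1)[OF that] by (simp add: complex_eq_iff)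
  have err1: "vderiv (\<lambda>x. ?G x - \<sigma> x) x = complex_of_real (g1 x - Re (vderiv \<sigma> x))" if x: "x \<in> {r 1..r n}" for x
  proof -
    have x0: "x > 0" using x assms(2) by auto
    have "(\<sigma> has_vector_derivative vderiv \<sigma> x) (at x)"
      using spline_derivative[OF assms(8) assms(1-3) x, of 0] by simp
    from has_vector_derivative_diff[OF has_vector_derivative_of_real[OF fe.g0[OF x0]] this]
    have "vderiv (\<lambda>x. ?G x - \<sigma> x) x = complex_of_real (g1 x) - vderiv \<sigma> x"
      unfolding vderiv_def[of "\<lambda>x. ?G x - \<sigma> x"] by (rule vector_derivative_at)
    then show ?thesis using Im0(2)[OF x] by (simp add: complex_eq_iff)
  qed
  note unif = R.uniform_bounds[of h, OF h, folded T_def] and msq = R.mean_square_bounds[of h, OF h, folded T_def]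
  have root: "sqrt (h * (T / r 1)) = sqrt h * sqrt T / sqrt (r 1)"
    by (simp add: real_sqrt_mult real_sqrt_divide)
  have nrm: "energy_norm k ?G = sqrt T" unfolding en T_def ..
  have hpow: "h powr (1/2) = sqrt h" "h powr (3/2) = h * sqrt h" "h powr 2 = h\<^sup>2"
  proof -
    show "h powr (1/2) = sqrt h" using h0 by (simp add: powr_half_sqrt)
    have "h powr (3/2) = h powr (1 + 1/2)" by simp
    also have "\<dots> = h * sqrt h" using h0 by (subst powr_add) (simp add: powr_half_sqrt)
    finally show "h powr (3/2) = h * sqrt h" .
    show "h powr 2 = h\<^sup>2" using h0 by simp
  qed
  have Tsq: "(sqrt T / sqrt (r 1))\<^sup>2 = T / r 1" using T assms(2) by (simp add: power_divide)
  have msq0: "integral {r 1..r n} (\<lambda>x. (g x - Re (\<sigma> x))\<^sup>2) \<le> (h / 2 * h * (sqrt T / sqrt (r 1)))\<^sup>2"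
    and msq1: "integral {r 1..r n} (\<lambda>x. (g1 x - Re (vderiv \<sigma> x))\<^sup>2) \<le> (h * (sqrt T / sqrt (r 1)))\<^sup>2"
    unfolding power_mult_distrib Tsq using msq by (simp_all only: power_mult_distrib)
  consider "m = 0" | "m = 1" using assms(10) by auto
  then show ?thesis
  proof cases
    case 1
    have norms: "Linf_norm {r 1..r n} (\<lambda>x. ?G x - \<sigma> x) \<le> ereal (h / 2 * sqrt (h * (T / r 1)))"
      "L2_norm {r 1..r n} (\<lambda>x. ?G x - \<sigma> x) \<le> ereal (h / 2 * h * (sqrt T / sqrt (r 1)))"
      using norms_le[OF R.error_continuous(1) err0 unif(2) msq0] h0 T assms(2) by simp_all
    have eqs: "h / 2 * sqrt (h * (T / r 1)) = 1 / (2 powr (1 - real m) * sqrt (r 1)) * h powr (3/2 - real m) * energy_norm k ?G"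
      "h / 2 * h * (sqrt T / sqrt (r 1)) = 1 / (2 powr (1 - real m) * sqrt (r 1)) * h powr (2 - real m) * energy_norm k ?G"
      unfolding root nrm 1 by (simp_all add: hpow power2_eq_square)
    show ?thesis using norms unfolding eqs by (simp add: 1)
  next
    case 2
    have norms: "Linf_norm {r 1..r n} (vderiv (\<lambda>x. ?G x - \<sigma> x)) \<le> ereal (sqrt (h * (T / r 1)))"
      "L2_norm {r 1..r n} (vderiv (\<lambda>x. ?G x - \<sigma> x)) \<le> ereal (h * (sqrt T / sqrt (r 1)))"
      using norms_le[OF R.error_continuous(2) err1 unif(1) msq1] h0 T assms(2) by simp_all
    have eqs: "sqrt (h * (T / r 1)) = 1 / (2 powr (1 - real m) * sqrt (r 1)) * h powr (3/2 - real m) * energy_norm k ?G"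
      "h * (sqrt T / sqrt (r 1)) = 1 / (2 powr (1 - real m) * sqrt (r 1)) * h powr (2 - real m) * energy_norm k ?G"
      unfolding root nrm 2 using h0 by (simp_all add: hpow)
    show ?thesis using norms unfolding eqs by (simp add: 2)
  qed
qed

end
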